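(* Let $\Omega \subset \mathbb{R}^N$ ($N\ge 2$) be a bounded measurable set with $|\Omega|>0$. Then for every $k \in \mathbb{N}$ and every $n \in \{1,\dots,k\}$ there exists an $n$-adjusted Cheeger $k$-tuple of $\Omega$.
   Context: $|\cdot|$ is Lebesgue measure and $P(E)=P(E;\mathbb{R}^N)$ is the distributional (De Giorgi) perimeter. For a measurable $D$ with $|D|>0$, $h_1(D)=\inf\{P(E)/|E| : E\subset D,\ |E|>0\}$. $\mathcal{E}_k(D)$ denotes the family of $k$-tuples $(E_1,\dots,E_k)$ of measurable subsets of $D$ with $|E_i|>0$ for all $i$ and $E_i\cap E_j=\emptyset$ for $i\ne j$, and $h_k(D)=\inf_{(E_1,\dots,E_k)\in\mathcal{E}_k(D)}\max_{i} P(E_i)/|E_i|$ (equivalently $\inf \max_i h_1(E_i)$). A Cheeger $k$-tuple of $D$ is an element of $\mathcal{E}_k(D)$ attaining this infimum. For $n\in\{1,\dots,k\}$, a Cheeger $k$-tuple $(E_1,\dots,E_k)$ of $\Omega$ is called $n$-adjusted if for every $l\in\{1,\dots,n\}$ and every choice of mutually distinct indices $i_1,\dots,i_l\in\{1,\dots,k\}$, the $l$-tuple $(E_{i_1},\dots,E_{i_l})$ is a Cheeger $l$-tuple of $\Omega\setminus\bigcup_{j\notin\{i_1,\dots,i_l\}}E_j$. (In particular, $1$-adjusted means each $E_i$ is a Cheeger set of $\Omega\setminus\bigcup_{j\neq i}E_j$, i.e. $h_1(\Omega\setminus\bigcup_{j\ne i}E_j)=h_1(E_i)=P(E_i)/|E_i|$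 for all $i$.) *)

theory Defs
  imports "HOL-Analysis.Analysis"
begin

definition divergence :: "('a::euclidean_space \<Rightarrow> 'a) \<Rightarrow> 'a \<Rightarrow> real" where
  "divergence \<phi> x = (\<Sum>b\<in>Basis. (frechet_derivative \<phi> (at x) b) \<bullet> b)"

definition test_fields :: "('a::euclidean_space \<Rightarrow> 'a) set" where
  "test_fields = {\<phi>. \<phi> differentiable_on UNIV
      \<and> (\<forall>b\<in>Basis. continuous_on UNIV (\<lambda>x. frechet_derivative \<phi> (at x) b))
      \<and> compact (closure {x. \<phi> x \<noteq> 0})
      \<and> (\<forall>x. norm (\<phi> x) \<le> 1)}"

definition perimeter :: "'a::euclidean_space set \<Rightarrow> ereal" where
  "perimeter E = (SUP \<phi>\<in>test_fields. ereal (LINT x:E|lebesgue. divergence \<phi> x))"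

definition cheeger_ratio :: "'a::euclidean_space set \<Rightarrow> ereal" where
  "cheeger_ratio E = perimeter E / ereal (measure lebesgue E)"

definition admissible_tuples :: "nat \<Rightarrow> 'a::euclidean_space set \<Rightarrow> (nat \<Rightarrow> 'a set) set" where
  "admissible_tuples k D = {E. (\<forall>i<k. E i \<in> sets lebesgue \<and> E i \<subseteq> D \<and> emeasure lebesgue (E i) > 0)
      \<and> (\<forall>i<k. \<forall>j<k. i \<noteq> j \<longrightarrow> E i \<inter> E j = {})}"

definition tuple_value :: "nat \<Rightarrow> (nat \<Rightarrow> 'a::euclidean_space set) \<Rightarrow> ereal" where
  "tuple_value k E = (SUP i\<in>{..<k}. cheeger_ratio (E i))"

definition cheeger_const :: "nat \<Rightarrow> 'a::euclidean_space set \<Rightarrow> ereal" where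
  "cheeger_const k D = (INF E\<in>admissible_tuples k D. tuple_value k E)"

definition cheeger_tuple :: "nat \<Rightarrow> 'a::euclidean_space set \<Rightarrow> (nat \<Rightarrow> 'a set) \<Rightarrow> bool" where
  "cheeger_tuple k D E \<longleftrightarrow> E \<in> admissible_tuples k D \<and> tuple_value k E = cheeger_const k D"

definition adjusted :: "nat \<Rightarrow> nat \<Rightarrow> 'a::euclidean_space set \<Rightarrow> (nat \<Rightarrow> 'a set) \<Rightarrow> bool" where
  "adjusted n k \<Omega> E \<longleftrightarrow> cheeger_tuple k \<Omega> E \<and>
     (\<forall>l\<in>{1..n}. \<forall>\<sigma>::nat\<Rightarrow>nat. inj_on \<sigma> {..<l} \<and> \<sigma> ` {..<l} \<subseteq> {..<k} \<longrightarrow>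
        cheeger_tuple l (\<Omega> - (\<Union>j\<in>{..<k} - \<sigma> ` {..<l}. E j)) (E \<circ> \<sigma>))"

end

theory Submission
  imports Defs
begin

text \<open>
  Order the ratios \<open>P(E\<^sub>i)/|E\<^sub>i|\<close> of a \<open>k\<close>-tuple decreasingly and minimise the resulting vector
  lexicographically. If the maximum over some index set \<open>I\<close> could be lowered by replacing only the
  sets \<open>E\<^sub>i\<close> with \<open>i \<in> I\<close> inside what the other sets leave free, the ordered vector would strictly
  decrease; hence a lexicographic minimiser is \<open>k\<close>-adjusted. It exists because each order statistic
  of lower semicontinuous functions is lower semicontinuous and because tuples of bounded ratio are
  compact in measure. If no subset of \<open>\<Omega>\<close> has finite perimeter, every tuple is adjusted; otherwise
  cutting along half-spaces yields \<open>k\<close> disjoint sets of finite perimeter.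

  Compactness, and the lower bound on \<open>|E|\<close>, both come from the translation estimate
  \<open>|{x \<in> E. x + h \<notin> E}| \<le> |h| P(E)\<close>: integrated over \<open>|h| < r\<close> it says that \<open>E\<close> is within
  \<open>O(r P(E))\<close> of its averages over balls of radius \<open>r\<close>.
\<close>

text \<open>Minimising the largest ratio alone leaves the smaller ratios uncontrolled, so a Cheeger
  \<open>k\<close>-tuple need not be adjusted. The ordered vector is a symmetric function of the
  ratios, so all choices of indices are handled at once. Compactness is available only for tuples
  whose ratios have a common finite bound \<open>K\<close>, so the minimisation is confined to
  these. This loses nothing: a competitor that lowers the maximum over \<open>I\<close> has its new
  ratios below an old one and respects the same bound. Two things could go wrong in the limit. A
  component could vanish; a volume bound depending only on \<open>K\<close> and the dimension
  excludes this. Disjointness and inclusion in \<Omega> could survive only almost everywhere; taking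
  as limit the points that lie eventually in the sets makes them exact. The fields behind the
  translation estimate have the form psi h with a constant vector h, since the divergence of such a
  field is the derivative of psi along h. Sets are replaced by Borel subsets of full measure first,
  so that Fubini and translation invariance can be applied to \<open>lborel\<close>.\<close>

section \<open>Test fields and perimeter\<close>

text \<open>The derivative is carried as an explicit function, so that divergences of products and
  compositions can be read off. Continuity is asked direction by direction, as in
  \<open>test_fields\<close>; in finite dimension this is the same as continuity in operator
  norm.\<close>

definition has_C1_derivative ::
  "('a::euclidean_space \<Rightarrow> 'b::real_normed_vector) \<Rightarrow> ('a \<Rightarrow> 'a \<Rightarrow> 'b) \<Rightarrow> bool" where
  "has_C1_derivative f f' \<longleftrightarrow>
     (\<forall>x. (f has_derivative f' x) (at x)) \<and> (\<forall>v. continuous_on UNIV (\<lambda>x. f' x v))"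

lemma has_C1_derivative_continuous:
  "has_C1_derivative f f' \<Longrightarrow> continuous_on S f"
  unfolding has_C1_derivative_def
  by (meson has_derivative_continuous continuous_at_imp_continuous_on)

lemma has_C1_derivative_const: "has_C1_derivative (\<lambda>x. c) (\<lambda>x v. 0)"
  by (simp add: has_C1_derivative_def)

lemma has_C1_derivative_bounded_linear:
  "bounded_linear f \<Longrightarrow> has_C1_derivative f (\<lambda>x. f)"
  by (simp add: has_C1_derivative_def bounded_linear_imp_has_derivative)

lemma has_C1_derivative_add:
  assumes "has_C1_derivative f f'" "has_C1_derivative g g'"
  shows "has_C1_derivative (\<lambda>x. f x + g x) (\<lambda>x v. f' x v + g' x v)"
  using assms unfolding has_C1_derivative_def
  by (auto intro!: derivative_eq_intros continuous_intros)

lemma has_C1_derivative_scaleR: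
  fixes f :: "'a::euclidean_space \<Rightarrow> real"
  assumes "has_C1_derivative f f'" "has_C1_derivative g g'"
  shows "has_C1_derivative (\<lambda>x. f x *\<^sub>R g x) (\<lambda>x v. f x *\<^sub>R g' x v + f' x v *\<^sub>R g x)"
  using assms has_C1_derivative_continuous[OF assms(1)] has_C1_derivative_continuous[OF assms(2)]
  unfolding has_C1_derivative_def
  by (auto intro!: derivative_eq_intros continuous_intros)

lemma has_C1_derivative_compose_real:
  fixes f :: "'a::euclidean_space \<Rightarrow> real"
  assumes "has_C1_derivative f f'" "\<And>y. (g has_real_derivative g' y) (at y)"
    and "continuous_on UNIV g'"
  shows "has_C1_derivative (\<lambda>x. g (f x)) (\<lambda>x v. g' (f x) * f' x v)"
  unfolding has_C1_derivative_def
proof safe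
  fix x v
  have "(f has_derivative f' x) (at x)"
    using assms(1) by (simp add: has_C1_derivative_def)
  from has_derivative_compose[OF this assms(2)[of "f x", unfolded has_field_derivative_def]]
  show "((\<lambda>x. g (f x)) has_derivative (\<lambda>v. g' (f x) * f' x v)) (at x)" .
  have "continuous_on UNIV (\<lambda>x. g' (f x))"
    using has_C1_derivative_continuous[OF assms(1)] assms(3)
    by (auto intro: continuous_on_compose2)
  then show "continuous_on UNIV (\<lambda>x. g' (f x) * f' x v)"
    using assms(1) by (auto simp: has_C1_derivative_def intro!: continuous_intros)
qed

lemma has_C1_derivative_translate:
  assumes "has_C1_derivative f f'"
  shows "has_C1_derivative (\<lambda>x. f (x - c)) (\<lambda>x. f' (x - c))"
  unfolding has_C1_derivative_def
proof safe
  fix x v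
  have "((\<lambda>x. x - c) has_derivative (\<lambda>v. v)) (at x)"
    by (auto intro!: derivative_eq_intros)
  moreover have "(f has_derivative f' (x - c)) (at (x - c))"
    using assms by (simp add: has_C1_derivative_def)
  ultimately show "((\<lambda>x. f (x - c)) has_derivative f' (x - c)) (at x)"
    using has_derivative_compose by fastforce
  show "continuous_on UNIV (\<lambda>x. f' (x - c) v)"
    using assms unfolding has_C1_derivative_def
    by (intro continuous_on_compose2[of UNIV "\<lambda>x. f' x v" UNIV "\<lambda>x. x - c"])
       (auto intro!: continuous_intros)
qed

lemma has_C1_derivative_real_polynomial:
  assumes "real_polynomial_function p"
  shows "\<exists>p'. has_C1_derivative p p'"
  using assms
proof induction
  case (linear f)
  then show ?case using has_C1_derivative_bounded_linear by blast
next
  case (const c)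
  then show ?case using has_C1_derivative_const by blast
next
  case (add f g)
  then show ?case using has_C1_derivative_add by blast
next
  case (mult f g)
  then show ?case using has_C1_derivative_scaleR[of f _ g] by fastforce
qed

lemma has_C1_derivative_zero_outside:
  assumes "has_C1_derivative f f'" "\<And>x. R < norm x \<Longrightarrow> f x = 0" "R < norm x"
  shows "f' x v = 0"
proof -
  have "((\<lambda>x. 0) has_derivative (\<lambda>v. 0)) (at x)" by simp
  then have "(f has_derivative (\<lambda>v. 0)) (at x)"
    by (rule has_derivative_transform_within_open[where s = "- cball 0 R"])
       (use assms in \<open>auto simp: open_Compl\<close>)
  moreover have "(f has_derivative f' x) (at x)"
    using assms(1) by (simp add: has_C1_derivative_def)
  ultimately have "f' x = (\<lambda>v. 0)" using has_derivative_unique by blast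
  then show ?thesis by simp
qed

lemma continuous_zero_outside_bounded:
  fixes f :: "'a::euclidean_space \<Rightarrow> real"
  assumes "continuous_on UNIV f" "\<And>x. R < norm x \<Longrightarrow> f x = 0"
  obtains B where "0 < B" "\<And>x. \<bar>f x\<bar> \<le> B"
proof -
  have "compact (f ` cball 0 R)"
    using assms(1) by (intro compact_continuous_image) (auto intro: continuous_on_subset)
  then obtain B where "0 < B" and B: "\<forall>y\<in>f ` cball 0 R. norm y \<le> B"
    using bounded_pos compact_imp_bounded by blast
  have "\<bar>f x\<bar> \<le> B" for x
    using B assms(2)[of x] \<open>0 < B\<close> by (cases "norm x \<le> R") auto
  with \<open>0 < B\<close> show ?thesis by (rule that)
qed

section \<open>Test fields and first bounds for the perimeter\<close>

text \<open>Turns a test field into the working format. Continuity of the derivative in the basis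
  directions extends to all directions by linearity, and the compact support is replaced by a
  radius.\<close>

lemma test_fields_cases:
  assumes "\<phi> \<in> test_fields"
  obtains \<phi>' R where "has_C1_derivative \<phi> \<phi>'" "\<And>x. R < norm x \<Longrightarrow> \<phi> x = 0"
    "\<And>x. norm (\<phi> x) \<le> 1" "\<And>x. divergence \<phi> x = (\<Sum>b\<in>Basis. \<phi>' x b \<bullet> b)"
proof -
  let ?d = "\<lambda>x. frechet_derivative \<phi> (at x)"
  have diff: "(\<phi> has_derivative ?d x) (at x)" for x
    using assms frechet_derivative_works[of \<phi> "at x"]
    by (auto simp: test_fields_def differentiable_on_def)
  have cont: "continuous_on UNIV (\<lambda>x. ?d x v)" for v
  proof -
    have "?d x v = (\<Sum>b\<in>Basis. (v \<bullet> b) *\<^sub>R ?d x b)" for x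
    proof -
      have lin: "linear (?d x)" using diff has_derivative_linear by blast
      have "?d x v = ?d x (\<Sum>b\<in>Basis. (v \<bullet> b) *\<^sub>R b)"
        by (simp add: euclidean_representation)
      then show ?thesis
        by (simp add: linear_sum[OF lin] linear_cmul[OF lin])
    qed
    moreover have "continuous_on UNIV (\<lambda>x. \<Sum>b\<in>Basis. (v \<bullet> b) *\<^sub>R ?d x b)"
      using assms by (auto simp: test_fields_def intro!: continuous_intros)
    ultimately show ?thesis by simp
  qed
  have "bounded {x. \<phi> x \<noteq> 0}"
    using assms by (simp add: test_fields_def)
  then obtain R where "\<forall>x\<in>{x. \<phi> x \<noteq> 0}. norm x \<le> R" using bounded_iff by blast
  then have "R < norm x \<Longrightarrow> \<phi> x = 0" for x by force
  then show thesis
    using diff cont assms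
    by (intro that[of ?d R]) (auto simp: has_C1_derivative_def divergence_def test_fields_def)
qed

lemma test_fieldsI:
  assumes "has_C1_derivative \<phi> \<phi>'" "\<And>x. R < norm x \<Longrightarrow> \<phi> x = 0"
    and "\<And>x. norm (\<phi> x) \<le> 1"
  shows "\<phi> \<in> test_fields" "divergence \<phi> x = (\<Sum>b\<in>Basis. \<phi>' x b \<bullet> b)"
proof -
  have fd: "frechet_derivative \<phi> (at x) = \<phi>' x" for x
    using assms(1) frechet_derivative_at unfolding has_C1_derivative_def by metis
  have "bounded {x. \<phi> x \<noteq> 0}"
    unfolding bounded_iff using assms(2) by (intro exI[of _ R]) (auto simp: not_less[symmetric])
  then have "compact (closure {x. \<phi> x \<noteq> 0})" by simp
  then show "\<phi> \<in> test_fields"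
    using assms unfolding test_fields_def has_C1_derivative_def
    by (auto simp: fd differentiable_on_def differentiable_def intro: has_derivative_at_withinI)
  show "divergence \<phi> x = (\<Sum>b\<in>Basis. \<phi>' x b \<bullet> b)" by (simp add: divergence_def fd)
qed

lemma divergence_test_field:
  assumes "\<phi> \<in> test_fields"
  shows "continuous_on UNIV (divergence \<phi>)" "\<exists>B>0. \<forall>x. \<bar>divergence \<phi> x\<bar> \<le> B"
proof -
  obtain \<phi>' R where *: "has_C1_derivative \<phi> \<phi>'" "\<And>x. R < norm x \<Longrightarrow> \<phi> x = 0"
    "\<And>x. divergence \<phi> x = (\<Sum>b\<in>Basis. \<phi>' x b \<bullet> b)"
    using test_fields_cases[OF assms] by metis
  have "continuous_on UNIV (\<lambda>x. \<Sum>b\<in>Basis. \<phi>' x b \<bullet> b)"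
    using *(1) unfolding has_C1_derivative_def by (auto intro!: continuous_intros)
  then show 1: "continuous_on UNIV (divergence \<phi>)" using *(3) by (simp cong: continuous_on_cong)
  have "divergence \<phi> x = 0" if "R < norm x" for x
    using has_C1_derivative_zero_outside[OF *(1,2) that] by (simp add: *(3))
  from continuous_zero_outside_bounded[OF 1 this] show "\<exists>B>0. \<forall>x. \<bar>divergence \<phi> x\<bar> \<le> B"
    by blast
qed

lemma zero_test_field: "(\<lambda>x. 0) \<in> test_fields"
  by (rule test_fieldsI(1)[OF has_C1_derivative_const, where R = 0]) auto

lemma perimeter_nonneg: "0 \<le> perimeter E"
proof -
  have "divergence (\<lambda>x. 0::'a) x = 0" for x
    by (subst test_fieldsI(2)[OF has_C1_derivative_const, where R = 0]) auto
  then show ?thesis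
    unfolding perimeter_def
    by (intro SUP_upper2[OF zero_test_field]) (simp add: set_lebesgue_integral_def)
qed

lemma perimeter_leI:
  assumes "\<And>\<phi>. \<phi> \<in> test_fields \<Longrightarrow> (LINT x:E|lebesgue. divergence \<phi> x) \<le> C"
  shows "perimeter E \<le> ereal C"
  unfolding perimeter_def using assms by (auto intro: SUP_least)

lemma perimeter_leD:
  assumes "perimeter E \<le> ereal C" "\<phi> \<in> test_fields"
  shows "(LINT x:E|lebesgue. divergence \<phi> x) \<le> C"
proof -
  have "ereal (LINT x:E|lebesgue. divergence \<phi> x) \<le> perimeter E"
    unfolding perimeter_def using assms(2) by (rule SUP_upper)
  also note assms(1)
  finally show ?thesis by simp
qed

lemma perimeter_bound_nonneg: "perimeter E \<le> ereal C \<Longrightarrow> 0 \<le> C"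
  using order_trans[OF perimeter_nonneg, of E "ereal C"] by simp

lemma set_integral_lebesgue_eq_lborel:
  fixes f :: "'a::euclidean_space \<Rightarrow> real"
  assumes "E \<in> sets borel" "f \<in> borel_measurable borel"
  shows "(LINT x:E|lebesgue. f x) = (LINT x:E|lborel. f x)"
  unfolding set_lebesgue_integral_def
  by (rule integral_completion) (use assms in measurable)

text \<open>The definition of the perimeter covers fields of norm at most 1; a field of norm at most
  \<open>M\<close> is reduced to it by scaling.\<close>

lemma perimeter_field_bound:
  fixes E :: "'a::euclidean_space set"
  assumes P: "perimeter E \<le> ereal C"
    and \<phi>: "has_C1_derivative \<phi> \<phi>'" "\<And>x. R < norm x \<Longrightarrow> \<phi> x = 0"
    and M: "\<And>x. norm (\<phi> x) \<le> M"
  shows "(LINT x:E|lebesgue. (\<Sum>b\<in>Basis. \<phi>' x b \<bullet> b)) \<le> M * C"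
proof -
  let ?I = "LINT x:E|lebesgue. (\<Sum>b\<in>Basis. \<phi>' x b \<bullet> b)"
  have bound: "?I \<le> K * C" if "M \<le> K" "0 < K" for K
  proof -
    let ?g = "\<lambda>x. (1 / K) *\<^sub>R \<phi> x"
    have d: "has_C1_derivative ?g (\<lambda>x v. (1 / K) *\<^sub>R \<phi>' x v)"
      using has_C1_derivative_scaleR[OF has_C1_derivative_const[of "1 / K"] \<phi>(1)] by simp
    have n: "norm (?g x) \<le> 1" for x
      using M[of x] that by (simp add: field_simps)
    have z: "R < norm x \<Longrightarrow> ?g x = 0" for x by (simp add: \<phi>(2))
    have "(LINT x:E|lebesgue. (1 / K) * (\<Sum>b\<in>Basis. \<phi>' x b \<bullet> b)) \<le> C"
      using perimeter_leD[OF P test_fieldsI(1)[OF d z n]]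
      by (simp add: test_fieldsI(2)[OF d z n] sum_divide_distrib)
    then show ?thesis using that by (simp add: field_simps)
  qed
  have "0 \<le> M" using M[of 0] norm_ge_zero order_trans by blast
  show ?thesis
  proof (cases "M = 0")
    case True
  have "?I \<le> 0 + e" if "0 < e" for e
    proof -
      have "?I \<le> e / (C + 1) * C"
        using bound[of "e / (C + 1)"] that True perimeter_bound_nonneg[OF P] by simp
      also have "\<dots> \<le> e" using that perimeter_bound_nonneg[OF P] by (simp add: field_simps)
      finally show ?thesis by simp
    qed
    then show ?thesis using True field_le_epsilon[of ?I 0] by simp
  next
    case False
    then show ?thesis using bound[of M] \<open>0 \<le> M\<close> by simp
  qed
qed

section \<open>C1 approximation of indicator functions\<close>

text \<open>Squaring removes the kink of the positive part. The result is the C1 building block of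
  both the cut-off at large radius and the step across a hyperplane.\<close>

lemma DERIV_max_0_power2:
  fixes y :: real
  shows "((\<lambda>y. (max 0 y)\<^sup>2) has_real_derivative 2 * max 0 y) (at y)"
proof (cases y "0::real" rule: linorder_cases)
  case less
  have "((\<lambda>y::real. 0) has_real_derivative 2 * max 0 y) (at y)" using less by simp
  then show ?thesis
    by (rule has_field_derivative_transform_within_open[where S = "{..<0}"]) (use less in auto)
next
  case equal
  have "((\<lambda>h. max 0 h) \<longlongrightarrow> max 0 0) (at (0::real))"
    by (intro tendsto_intros)
  moreover have "\<forall>\<^sub>F h in at (0::real). max 0 h = ((max 0 (0 + h))\<^sup>2 - (max 0 0)\<^sup>2) / h"
    by (auto simp: eventually_at_filter max_def power2_eq_square)
  ultimately have "((\<lambda>h. ((max 0 (0 + h))\<^sup>2 - (max 0 0)\<^sup>2) / h) \<longlongrightarrow> max 0 0) (at (0::real))"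
    by (rule Lim_transform_eventually)
  then show ?thesis using equal by (simp add: DERIV_def)
next
  case greater
  have "((\<lambda>y::real. y\<^sup>2) has_real_derivative 2 * max 0 y) (at y)"
    using greater by (auto intro!: derivative_eq_intros)
  then show ?thesis
    by (rule has_field_derivative_transform_within_open[where S = "{0<..}"]) (use greater in auto)
qed

text \<open>A measurable function is an a.e. limit of continuous ones. These are clipped to values
  in [0,1], replaced by polynomials that are close on larger and larger balls, and multiplied by C1
  cut-offs.\<close>

lemma C1_approx_indicator:
  fixes A :: "'a::euclidean_space set"
  assumes "A \<in> sets borel"
  obtains \<psi> \<psi>' where "\<And>n::nat. has_C1_derivative (\<psi> n) (\<psi>' n)"
    "\<And>n x. real (Suc n) < norm x \<Longrightarrow> \<psi> n x = (0::real)" "\<And>n x. \<bar>\<psi> n x\<bar> \<le> 1"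
    "AE x in lborel. (\<lambda>n. \<psi> n x) \<longlonglongrightarrow> indicator A x"
proof -
  have "(indicator A :: 'a \<Rightarrow> real) measurable_on UNIV"
    using assms by (intro lebesgue_measurable_imp_measurable_on borel_measurable_indicator) auto
  then obtain N g where N: "negligible N" and g: "\<And>n. continuous_on UNIV (g n)"
    and lim: "\<And>x. x \<notin> N \<Longrightarrow> (\<lambda>n::nat. g n x) \<longlonglongrightarrow> (indicator A x :: real)"
    unfolding measurable_on_def by auto
  define h where "h n x = max 0 (min 1 (g n x))" for n x
  have h: "continuous_on S (h n)" for n S
    unfolding h_def using g by (auto intro!: continuous_intros intro: continuous_on_subset)
  have "\<exists>p. real_polynomial_function p \<and> (\<forall>x\<in>cball 0 (Suc n). \<bar>h n x - p x\<bar> < 1 / Suc n)" for n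
  proof -
    have "(0::real) < 1 / Suc n" by simp
    then show ?thesis
      using Stone_Weierstrass_real_polynomial_function[OF compact_cball h] by metis
  qed
  then obtain p where p: "\<And>n. real_polynomial_function (p n)"
    and hp: "\<And>n x. norm x \<le> Suc n \<Longrightarrow> \<bar>h n x - p n x\<bar> < 1 / Suc n"
    by (metis mem_cball_0)
  obtain p' where p': "\<And>n. has_C1_derivative (p n) (p' n)"
    using has_C1_derivative_real_polynomial[OF p] by metis
  \<comment> \<open>A C1 cut-off that vanishes outside the ball of radius \<open>Suc n\<close>,
    where the polynomial is uncontrolled, and tends to 1 at every point.\<close>
  define k where "k n x = (max 0 (1 - (x \<bullet> x) / (Suc n)\<^sup>2))\<^sup>2" for n and x :: 'a
  have k1: "\<bar>k n x\<bar> \<le> 1" for n x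
    unfolding k_def by (auto simp: power_le_one_iff max_def)
  have k0: "k n x = 0" if "Suc n < norm x" for n x
  proof -
    have "(real (Suc n))\<^sup>2 < (norm x)\<^sup>2" using that by (intro power_strict_mono) auto
    then have "1 - (x \<bullet> x) / (real (Suc n))\<^sup>2 \<le> 0"
      using that by (simp add: dot_square_norm le_divide_eq_1_pos del: of_nat_Suc)
    then show ?thesis by (simp add: k_def)
  qed
  have "\<exists>k'. has_C1_derivative (k n) k'" for n
  proof -
    have q: "real_polynomial_function (\<lambda>x::'a. x \<bullet> x)"
      by (subst euclidean_inner)
         (intro real_polynomial_function_sum real_polynomial_function.intros bounded_linear_inner_left; simp)
    have "real_polynomial_function (\<lambda>x::'a. 1 - (x \<bullet> x) / (Suc n)\<^sup>2)"
      using real_polynomial_function.intros(4)[OF real_polynomial_function.intros(2)[of "1/(Suc n)\<^sup>2"] q]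
      by (intro real_polynomial_function_diff real_polynomial_function.intros(2)) (simp add: mult.commute)
    then obtain q' where q': "has_C1_derivative (\<lambda>x::'a. 1 - (x \<bullet> x) / (Suc n)\<^sup>2) q'"
      using has_C1_derivative_real_polynomial by blast
    from has_C1_derivative_compose_real[OF q' DERIV_max_0_power2] show ?thesis
      unfolding k_def by (fastforce intro!: continuous_intros)
  qed
  then obtain k' where k': "\<And>n. has_C1_derivative (k n) (k' n)" by metis
  \<comment> \<open>The polynomial may exceed 1 by the approximation error \<open>1 / Suc n\<close>;
    the last factor restores the bound 1 and tends to 1.\<close>
  define \<psi> where "\<psi> n x = k n x * (p n x * (1 / (1 + 1 / Suc n)))" for n x
  have z: "\<psi> n x = 0" if "real (Suc n) < norm x" for n x
    using k0[OF that] by (simp add: \<psi>_def)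
  have le: "\<bar>\<psi> n x\<bar> \<le> 1" for n x
  proof (cases "norm x \<le> Suc n")
    case True
    have "\<bar>h n x\<bar> \<le> 1" by (simp add: h_def)
    with hp[OF True] have "\<bar>p n x\<bar> \<le> 1 + 1 / Suc n" by linarith
    moreover have "0 < 1 + 1 / real (Suc n)" by (intro add_pos_pos) auto
    ultimately have "\<bar>p n x * (1 / (1 + 1 / Suc n))\<bar> \<le> 1"
      by (simp add: abs_mult divide_le_eq del: of_nat_Suc)
    then show ?thesis unfolding \<psi>_def abs_mult[of "k n x"] using k1[of n x] by (intro mult_le_one) auto
  next
    case False
    then show ?thesis using z[of n x] by simp
  qed
  have d: "\<exists>d. has_C1_derivative (\<psi> n) d" for n
    using has_C1_derivative_scaleR[OF k'[of n] has_C1_derivative_scaleR[OF p'[of n]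
      has_C1_derivative_const[of "1 / (1 + 1 / real (Suc n))"]]]
    unfolding \<psi>_def real_scaleR_def by fast
  have inv: "(\<lambda>n. 1 / real (Suc n)) \<longlonglongrightarrow> 0" 
    using LIMSEQ_inverse_real_of_nat by (simp add: inverse_eq_divide)
  have "(\<lambda>n. \<psi> n x) \<longlonglongrightarrow> indicator A x" if "x \<notin> N" for x
  proof -
    have h_lim: "(\<lambda>n. h n x) \<longlonglongrightarrow> max 0 (min 1 (indicator A x))"
      unfolding h_def by (intro tendsto_intros lim that)
    have ev: "\<forall>\<^sub>F n in sequentially. norm (p n x - h n x) \<le> 1 / real (Suc n)"
    proof -
      obtain n0 where "norm x \<le> real n0" using real_arch_simple by blast
      then show ?thesis
        using hp by (intro eventually_sequentiallyI[of n0]) (smt (verit) of_nat_Suc of_nat_mono real_norm_def)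
    qed
    have "(\<lambda>n. p n x - h n x) \<longlonglongrightarrow> 0"
      using tendsto_norm_zero_cancel[OF tendsto_sandwich[OF _ ev tendsto_const inv]] by auto
    from tendsto_add[OF this h_lim] have p_lim: "(\<lambda>n. p n x) \<longlonglongrightarrow> indicator A x"
      by (auto simp: indicator_def split: if_splits)
    have k_lim: "(\<lambda>n. k n x) \<longlonglongrightarrow> (max 0 (1 - (x \<bullet> x) * 0\<^sup>2))\<^sup>2"
    proof -
      have "(\<lambda>n. (max 0 (1 - (x \<bullet> x) * (1 / real (Suc n))\<^sup>2))\<^sup>2) \<longlonglongrightarrow> (max 0 (1 - (x \<bullet> x) * 0\<^sup>2))\<^sup>2"
        by (intro tendsto_intros inv)
      then show ?thesis by (simp add: k_def power_divide)
    qed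
    have "(\<lambda>n. 1 / (1 + 1 / real (Suc n))) \<longlonglongrightarrow> 1 / (1 + 0)"
      by (intro tendsto_intros inv) auto
    from tendsto_mult[OF k_lim tendsto_mult[OF p_lim this]]
    show ?thesis unfolding \<psi>_def by simp
  qed
  moreover have "AE x in lebesgue. x \<notin> N"
    using N by (simp add: AE_not_in negligible_iff_null_sets)
  ultimately have "AE x in lborel. (\<lambda>n. \<psi> n x) \<longlonglongrightarrow> indicator A x"
    by (subst AE_completion_iff[symmetric]) (auto elim: eventually_mono)
  moreover obtain d where "\<And>n. has_C1_derivative (\<psi> n) (d n)" using d by metis
  ultimately show thesis using that z le by blast
qed

section \<open>The translation estimate\<close>

lemma integral_lborel_translate:
  fixes f :: "'a::euclidean_space \<Rightarrow> real"
  assumes "f \<in> borel_measurable borel"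
  shows "(LINT x|lborel. f (h + x)) = (LINT x|lborel. f x)"
  using integral_distr[of "(+) h" lborel borel f] assms by (simp add: lborel_distr_plus)

lemma nn_integral_lborel_translate:
  fixes f :: "'a::euclidean_space \<Rightarrow> ennreal"
  assumes "f \<in> borel_measurable borel"
  shows "(\<integral>\<^sup>+x. f (h + x) \<partial>lborel) = (\<integral>\<^sup>+x. f x \<partial>lborel)"
  using nn_integral_distr[of "(+) h" lborel borel f] assms by (simp add: lborel_distr_plus)

text \<open>Differentiation under the integral sign: the mean value inequality bounds the difference
  quotients by the supremum \<open>B\<close> of the directional derivative, which is integrable over
  a set of finite measure.\<close>

lemma DERIV_integral_translate:
  fixes E :: "'a::euclidean_space set"
  assumes E: "E \<in> sets borel" "emeasure lborel E < \<infinity>"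
    and \<psi>: "has_C1_derivative \<psi> \<psi>'" "\<And>x. R < norm x \<Longrightarrow> \<psi> x = (0::real)"
  shows "((\<lambda>t. LINT x:E|lborel. \<psi> (x - t *\<^sub>R h)) has_real_derivative
     - (LINT x:E|lborel. \<psi>' (x - t *\<^sub>R h) h)) (at t)"
proof -
  note E[measurable]
  have cont: "continuous_on UNIV \<psi>" "continuous_on UNIV (\<lambda>x. \<psi>' x h)"
    using \<psi>(1) has_C1_derivative_continuous by (auto simp: has_C1_derivative_def)
  have [measurable]: "\<psi> \<in> borel_measurable borel" "(\<lambda>x. \<psi>' x h) \<in> borel_measurable borel"
    using cont borel_measurable_continuous_onI by auto
  obtain B0 where B0: "\<And>x. \<bar>\<psi> x\<bar> \<le> B0"
    using continuous_zero_outside_bounded[OF cont(1) \<psi>(2)] by metis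
  have "\<psi>' x h = 0" if "R < norm x" for x
    using has_C1_derivative_zero_outside[OF \<psi> that] .
  from continuous_zero_outside_bounded[OF cont(2) this]
  obtain B where "0 < B" and B: "\<And>x. \<bar>\<psi>' x h\<bar> \<le> B" by metis
  have der: "((\<lambda>u. \<psi> (x - u *\<^sub>R h)) has_real_derivative - \<psi>' (x - u *\<^sub>R h) h) (at u)" for x u
  proof -
    have "((\<lambda>u. x - u *\<^sub>R h) has_derivative (\<lambda>s. - s *\<^sub>R h)) (at u)"
      by (auto intro!: derivative_eq_intros)
    moreover have d: "(\<psi> has_derivative \<psi>' (x - u *\<^sub>R h)) (at (x - u *\<^sub>R h))"
      using \<psi>(1) by (simp add: has_C1_derivative_def)
    ultimately have "((\<lambda>u. \<psi> (x - u *\<^sub>R h)) has_derivative (\<lambda>s. \<psi>' (x - u *\<^sub>R h) (- s *\<^sub>R h))) (at u)"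
      by (rule has_derivative_compose)
    moreover have "(\<lambda>s. \<psi>' (x - u *\<^sub>R h) (- s *\<^sub>R h)) = (*) (- \<psi>' (x - u *\<^sub>R h) h)"
      using linear_cmul[OF has_derivative_linear[OF d], of "- s" h for s] by (simp add: fun_eq_iff)
    ultimately show ?thesis by (simp add: has_field_derivative_def)
  qed
  have int: "integrable lborel (\<lambda>x. indicator E x * \<psi> (x - u *\<^sub>R h))" for u
  proof (rule Bochner_Integration.integrable_bound)
    show "integrable lborel (\<lambda>x. B0 * indicator E x)" using E by simp
    show "AE x in lborel. norm (indicator E x * \<psi> (x - u *\<^sub>R h)) \<le> norm (B0 * indicator E x)"
      using B0 order_trans[OF abs_ge_zero B0] by (intro AE_I2) (auto simp: indicator_def)
  qed measurable
  show ?thesis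
    unfolding DERIV_def tendsto_at_iff_sequentially
  proof safe
    fix s :: "nat \<Rightarrow> real"
    assume s: "\<forall>i. s i \<in> UNIV - {0}" "s \<longlonglongrightarrow> 0"
    let ?q = "\<lambda>i x. (\<psi> (x - (t + s i) *\<^sub>R h) - \<psi> (x - t *\<^sub>R h)) / s i"
    have eq: "((LINT x:E|lborel. \<psi> (x - (t + s i) *\<^sub>R h)) - (LINT x:E|lborel. \<psi> (x - t *\<^sub>R h))) / s i =
        (LINT x|lborel. indicator E x * ?q i x)" for i
      unfolding set_lebesgue_integral_def real_scaleR_def
      by (subst Bochner_Integration.integral_diff[OF int int, symmetric],
          subst Bochner_Integration.integral_divide_zero[symmetric])
         (simp add: algebra_simps diff_divide_distrib)
    have "(\<lambda>i. LINT x|lborel. indicator E x * ?q i x) \<longlonglongrightarrow>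
        (LINT x|lborel. indicator E x * (- \<psi>' (x - t *\<^sub>R h) h))"
    proof (rule integral_dominated_convergence[where w = "\<lambda>x. B * indicator E x"])
      show "AE x in lborel. (\<lambda>i. indicator E x * ?q i x) \<longlonglongrightarrow> indicator E x * (- \<psi>' (x - t *\<^sub>R h) h)"
      proof (intro AE_I2 tendsto_mult tendsto_const)
        fix x
        show "(\<lambda>i. ?q i x) \<longlonglongrightarrow> - \<psi>' (x - t *\<^sub>R h) h"
          using der[where x = x and u = t] s
          by (auto simp: DERIV_def tendsto_at_iff_sequentially comp_def)
      qed
      show "AE x in lborel. norm (indicator E x * ?q i x) \<le> B * indicator E x" for i
      proof (intro AE_I2)
        fix x
        have "norm (\<psi> (x - (t + s i) *\<^sub>R h) - \<psi> (x - t *\<^sub>R h)) \<le> B * norm (t + s i - t)"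
          by (rule field_differentiable_bound[of UNIV, OF _ der]) (use B in auto)
        then show "norm (indicator E x * ?q i x) \<le> B * indicator E x"
          using s(1) by (auto simp: indicator_def field_simps)
      qed
      show "integrable lborel (\<lambda>x. B * indicator E x)" using E by simp
    qed measurable
    then show "((\<lambda>s. ((LINT x:E|lborel. \<psi> (x - (t + s) *\<^sub>R h)) -
        (LINT x:E|lborel. \<psi> (x - t *\<^sub>R h))) / s) \<circ> s) \<longlonglongrightarrow> - (LINT x:E|lborel. \<psi>' (x - t *\<^sub>R h) h)"
      unfolding comp_def eq by (simp add: set_lebesgue_integral_def)
  qed
qed

text \<open>By the mean value theorem the difference is, for some \<open>u\<close>, the integral
  over \<open>E\<close> of the derivative of the shifted \<psi> along \<open>h\<close>. That
  derivative is the divergence of the field \<open>\<psi> (x - u *\<^sub>R h) *\<^sub>R h\<close>,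
  whose norm is at most \<open>norm h\<close>.\<close>

lemma integral_translate_diff_le:
  fixes E :: "'a::euclidean_space set"
  assumes E: "E \<in> sets borel" "emeasure lborel E < \<infinity>" and P: "perimeter E \<le> ereal C"
    and \<psi>: "has_C1_derivative \<psi> \<psi>'" "\<And>x. R < norm x \<Longrightarrow> \<psi> x = 0" "\<And>x. \<bar>\<psi> x\<bar> \<le> 1"
  shows "(LINT x:E|lborel. \<psi> x) - (LINT x:E|lborel. \<psi> (x - h)) \<le> norm h * C"
proof -
  define F where "F t = (LINT x:E|lborel. \<psi> (x - t *\<^sub>R h))" for t
  define D where "D t = - (LINT x:E|lborel. \<psi>' (x - t *\<^sub>R h) h)" for t
  have "(F has_real_derivative D t) (at t)" for t
    unfolding F_def D_def by (rule DERIV_integral_translate[OF E \<psi>(1,2)])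
  then obtain u where u: "F 1 - F 0 = D u"
    using MVT2[of 0 1 F D] by auto
  have d: "has_C1_derivative (\<lambda>x. \<psi> (x - u *\<^sub>R h) *\<^sub>R h) (\<lambda>x v. \<psi>' (x - u *\<^sub>R h) v *\<^sub>R h)"
    using has_C1_derivative_scaleR[OF has_C1_derivative_translate[OF \<psi>(1)] has_C1_derivative_const[of h]]
    by simp
  have "(LINT x:E|lebesgue. (\<Sum>b\<in>Basis. (\<psi>' (x - u *\<^sub>R h) b *\<^sub>R h) \<bullet> b)) \<le> norm h * C"
  proof (rule perimeter_field_bound[OF P d, where R = "R + norm (u *\<^sub>R h)"])
    fix x :: 'a
    show "norm (\<psi> (x - u *\<^sub>R h) *\<^sub>R h) \<le> norm h"
      using \<psi>(3) by (simp add: mult_left_le_one_le)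
    assume "R + norm (u *\<^sub>R h) < norm x"
    then have "R < norm (x - u *\<^sub>R h)" using norm_triangle_ineq2[of x "u *\<^sub>R h"] by linarith
    then show "\<psi> (x - u *\<^sub>R h) *\<^sub>R h = 0" by (simp add: \<psi>(2))
  qed
  moreover have "(\<Sum>b\<in>Basis. (\<psi>' y b *\<^sub>R h) \<bullet> b) = \<psi>' y h" for y
  proof -
    have lin: "linear (\<psi>' y)"
      using \<psi>(1) has_derivative_linear by (auto simp: has_C1_derivative_def)
    have "\<psi>' y h = \<psi>' y (\<Sum>b\<in>Basis. (h \<bullet> b) *\<^sub>R b)" by (simp add: euclidean_representation)
    then show ?thesis by (simp add: linear_sum[OF lin] linear_cmul[OF lin] mult.commute)
  qed
  moreover have "(\<lambda>x. \<psi>' (x - u *\<^sub>R h) h) \<in> borel_measurable borel"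
    using has_C1_derivative_translate[OF \<psi>(1), of "u *\<^sub>R h"]
    by (intro borel_measurable_continuous_onI) (simp add: has_C1_derivative_def)
  ultimately have "- D u \<le> norm h * C"
    unfolding D_def using E(1) by (simp add: set_integral_lebesgue_eq_lborel)
  with u show ?thesis by (simp add: F_def)
qed

text \<open>A change of variables writes the previous left side as the integral of \<psi> against
  the indicator of \<open>E\<close> minus that of \<open>?S\<close>. Letting \<psi> tend to the
  indicator of \<open>?A\<close>, which is \<open>E\<close> without \<open>?S\<close>, leaves
  exactly the measure of \<open>?A\<close>.\<close>

lemma measure_translate_diff_le:
  fixes E :: "'a::euclidean_space set"
  assumes E: "E \<in> sets borel" "emeasure lborel E < \<infinity>" and P: "perimeter E \<le> ereal C"
  shows "measure lborel {x \<in> E. h + x \<notin> E} \<le> norm h * C"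
proof -
  note E[measurable]
  let ?A = "{x \<in> E. h + x \<notin> E}" and ?S = "{x. h + x \<in> E}"
  have [measurable]: "?A \<in> sets borel" "?S \<in> sets borel" by measurable
  have S: "emeasure lborel ?S < \<infinity>"
  proof -
    have "emeasure lborel ?S = (\<integral>\<^sup>+x. indicator ?S x \<partial>lborel)" by simp
    also have "\<dots> = (\<integral>\<^sup>+x. indicator E (h + x) \<partial>lborel)"
      by (intro nn_integral_cong) (simp add: indicator_def)
    also have "\<dots> = (\<integral>\<^sup>+x. indicator E x \<partial>lborel)"
      by (rule nn_integral_lborel_translate) measurable
    also have "\<dots> = emeasure lborel E" by (rule nn_integral_indicator) simp
    finally have "emeasure lborel ?S = emeasure lborel E" .
    then show ?thesis using E(2) by (rule ssubst)
  qed
  obtain \<psi> \<psi>' where \<psi>: "\<And>n::nat. has_C1_derivative (\<psi> n) (\<psi>' n)"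
    "\<And>n x. real (Suc n) < norm x \<Longrightarrow> \<psi> n x = (0::real)" "\<And>n x. \<bar>\<psi> n x\<bar> \<le> 1"
    "AE x in lborel. (\<lambda>n. \<psi> n x) \<longlonglongrightarrow> indicator ?A x"
    by (rule C1_approx_indicator[OF \<open>?A \<in> sets borel\<close>]) (rule that)
  have [measurable]: "\<psi> n \<in> borel_measurable borel" for n
    using has_C1_derivative_continuous[OF \<psi>(1)] by (rule borel_measurable_continuous_onI)
  let ?f = "\<lambda>x. indicator E x - indicator ?S x :: real"
  have int: "integrable lborel (\<lambda>x. indicator T x * \<psi> n x)"
    if [measurable]: "T \<in> sets borel" and "emeasure lborel T < \<infinity>" for T n
    by (rule Bochner_Integration.integrable_bound[of _ "indicator T :: 'a \<Rightarrow> real"])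
       (use \<psi>(3) that in \<open>auto simp: indicator_def\<close>)
  have "(LINT x|lborel. ?f x * \<psi> n x) \<le> norm h * C" for n
  proof -
    have "(LINT x:E|lborel. \<psi> n (x - h)) = (LINT x|lborel. indicator ?S x * \<psi> n x)"
      using integral_lborel_translate[of "\<lambda>x. indicator E x * \<psi> n (x - h)" h]
      by (simp add: set_lebesgue_integral_def indicator_def)
    then have "(LINT x|lborel. ?f x * \<psi> n x) = (LINT x:E|lborel. \<psi> n x) - (LINT x:E|lborel. \<psi> n (x - h))"
      using int[of E n] int[of ?S n] E S by (simp add: set_lebesgue_integral_def left_diff_distrib)
    then show ?thesis
      using integral_translate_diff_le[OF E P \<psi>(1-3)] by simp
  qed
  moreover have "(\<lambda>n. LINT x|lborel. ?f x * \<psi> n x) \<longlonglongrightarrow> (LINT x|lborel. ?f x * indicator ?A x)"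
  proof (rule integral_dominated_convergence[where w = "\<lambda>x. indicator E x + indicator ?S x"])
    show "AE x in lborel. (\<lambda>n. ?f x * \<psi> n x) \<longlonglongrightarrow> ?f x * indicator ?A x"
      using \<psi>(4) by eventually_elim (intro tendsto_intros)
    show "AE x in lborel. norm (?f x * \<psi> n x) \<le> indicator E x + indicator ?S x" for n
      using \<psi>(3) by (intro AE_I2) (auto simp: indicator_def abs_mult)
    show "integrable lborel (\<lambda>x. indicator E x + indicator ?S x :: real)"
      using E S by simp
  qed measurable
  ultimately have "(LINT x|lborel. ?f x * indicator ?A x) \<le> norm h * C"
    using LIMSEQ_le_const2 by blast
  moreover have "?f x * indicator ?A x = indicator ?A x" for x by (simp add: indicator_def)
  ultimately show ?thesis by simp
qed

section \<open>Pairs of points at distance below r on opposite sides of a set\<close>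

text \<open>With \<open>y = x + h\<close> and Fubini, the double integral becomes the integral over
  \<open>norm h < r\<close> of the measures bounded in \<open>measure_translate_diff_le\<close>,
  each at most \<open>r * C\<close>.\<close>

lemma interaction_le:
  fixes E :: "'a::euclidean_space set"
  assumes E: "E \<in> sets borel" "emeasure lborel E < \<infinity>" and P: "perimeter E \<le> ereal C" and "0 \<le> r"
  shows "(\<integral>\<^sup>+x. \<integral>\<^sup>+y. indicator E x * indicator (-E) y * indicator {y. dist x y < r} y \<partial>lborel \<partial>lborel)
    \<le> ennreal (r * C) * emeasure lborel (ball (0::'a) r)"
proof -
  note E[measurable]
  have 1: "(\<integral>\<^sup>+y. indicator E x * indicator (-E) y * indicator {y. dist x y < r} y \<partial>lborel) =
      (\<integral>\<^sup>+h. indicator {x \<in> E. h + x \<notin> E} x * indicator {h. norm h < r} h \<partial>lborel)" for x :: 'a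
  proof -
    have "(\<integral>\<^sup>+y. indicator E x * indicator (-E) y * indicator {y. dist x y < r} y \<partial>lborel) =
      (\<integral>\<^sup>+h. indicator E x * indicator (-E) (x + h) * indicator {y. dist x y < r} (x + h) \<partial>lborel)"
      by (rule nn_integral_lborel_translate[symmetric]) measurable
    also have "\<dots> = (\<integral>\<^sup>+h. indicator {x \<in> E. h + x \<notin> E} x * indicator {h. norm h < r} h \<partial>lborel)"
      by (intro nn_integral_cong) (auto simp: indicator_def dist_norm add.commute)
    finally show ?thesis .
  qed
  have "(\<integral>\<^sup>+x. \<integral>\<^sup>+y. indicator E x * indicator (-E) y * indicator {y. dist x y < r} y \<partial>lborel \<partial>lborel) =
    (\<integral>\<^sup>+h. \<integral>\<^sup>+x. indicator {x \<in> E. h + x \<notin> E} x * indicator {h. norm h < r} h \<partial>lborel \<partial>lborel)"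
    unfolding 1 by (rule lborel_pair.Fubini') measurable
  also have "\<dots> = (\<integral>\<^sup>+h. emeasure lborel {x \<in> E. h + x \<notin> E} * indicator {h. norm h < r} h \<partial>lborel)"
  proof (intro nn_integral_cong)
    fix h :: 'a
    have A: "{x \<in> E. h + x \<notin> E} \<in> sets lborel" by measurable
    then show "(\<integral>\<^sup>+x. indicator {x \<in> E. h + x \<notin> E} x * indicator {h. norm h < r} h \<partial>lborel) =
        emeasure lborel {x \<in> E. h + x \<notin> E} * indicator {h. norm h < r} h"
      by (subst nn_integral_multc) (auto intro!: borel_measurable_indicator)
  qed
  also have "\<dots> \<le> (\<integral>\<^sup>+h. ennreal (r * C) * indicator {h::'a. norm h < r} h \<partial>lborel)"
  proof (intro nn_integral_mono)
    fix h :: 'a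
    have "emeasure lborel {x \<in> E. h + x \<notin> E} \<le> emeasure lborel E"
      by (intro emeasure_mono) auto
    then have "emeasure lborel {x \<in> E. h + x \<notin> E} = ennreal (measure lborel {x \<in> E. h + x \<notin> E})"
      using E(2) by (intro emeasure_eq_ennreal_measure) (auto simp: top_unique)
    moreover have "measure lborel {x \<in> E. h + x \<notin> E} \<le> r * C" if "norm h < r"
      using measure_translate_diff_le[OF E P, of h] mult_right_mono[of "norm h" r C]
        perimeter_bound_nonneg[OF P] that by linarith
    ultimately show "emeasure lborel {x \<in> E. h + x \<notin> E} * indicator {h. norm h < r} h
        \<le> ennreal (r * C) * indicator {h. norm h < r} h"
      by (auto simp: indicator_def intro: ennreal_leI)
  qed
  also have "\<dots> = ennreal (r * C) * emeasure lborel (ball (0::'a) r)"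
    by (subst nn_integral_cmult_indicator) (auto simp: ball_def)
  finally show ?thesis .
qed

text \<open>Integrating over the outer point \<open>y\<close> first shows how much of the balls
  about points of \<open>E\<close> is missed by \<open>E\<close>.\<close>

lemma interaction_inner_le:
  fixes E :: "'a::euclidean_space set"
  assumes E: "E \<in> sets borel" "emeasure lborel E < \<infinity>" and P: "perimeter E \<le> ereal C" and "0 \<le> r"
  shows "(\<integral>\<^sup>+x. indicator E x * emeasure lborel (ball x r - E) \<partial>lborel)
    \<le> ennreal (r * C) * emeasure lborel (ball (0::'a) r)"
proof -
  note E[measurable]
  have "(\<integral>\<^sup>+y. indicator E x * indicator (-E) y * indicator {y. dist x y < r} y \<partial>lborel) =
      indicator E x * emeasure lborel (ball x r - E)" (is "_ = ?R") for x
  proof -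
    have "(\<integral>\<^sup>+y. indicator E x * indicator (-E) y * indicator {y. dist x y < r} y \<partial>lborel) =
        (\<integral>\<^sup>+y. indicator E x * indicator (ball x r - E) y \<partial>lborel)"
      by (intro nn_integral_cong) (auto simp: indicator_def)
    also have "\<dots> = ?R"
      by (rule nn_integral_cmult_indicator) simp
    finally show ?thesis .
  qed
  with interaction_le[OF assms] show ?thesis by simp
qed

text \<open>The same double integral in the other order: how much of \<open>E\<close> is seen within
  distance \<open>r\<close> from points outside.\<close>

lemma interaction_outer_le:
  fixes E :: "'a::euclidean_space set"
  assumes E: "E \<in> sets borel" "emeasure lborel E < \<infinity>" and P: "perimeter E \<le> ereal C" and "0 \<le> r"
  shows "(\<integral>\<^sup>+x. indicator (-E) x * emeasure lborel (E \<inter> ball x r) \<partial>lborel)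
    \<le> ennreal (r * C) * emeasure lborel (ball (0::'a) r)"
proof -
  note E[measurable]
  have "(\<integral>\<^sup>+x. indicator E x * indicator (-E) y * indicator {y. dist x y < r} y \<partial>lborel) =
      indicator (-E) y * emeasure lborel (E \<inter> ball y r)" (is "_ = ?R") for y
  proof -
    have "(\<integral>\<^sup>+x. indicator E x * indicator (-E) y * indicator {y. dist x y < r} y \<partial>lborel) =
        (\<integral>\<^sup>+x. indicator (-E) y * indicator (E \<inter> ball y r) x \<partial>lborel)"
      by (intro nn_integral_cong) (auto simp: indicator_def dist_commute)
    also have "\<dots> = ?R"
      by (rule nn_integral_cmult_indicator) simp
    finally show ?thesis .
  qed
  moreover have "(\<integral>\<^sup>+y. \<integral>\<^sup>+x. indicator E x * indicator (-E) y * indicator {y. dist x y < r} y \<partial>lborel \<partial>lborel) =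
    (\<integral>\<^sup>+x. \<integral>\<^sup>+y. indicator E x * indicator (-E) y * indicator {y. dist x y < r} y \<partial>lborel \<partial>lborel)"
    by (rule lborel_pair.Fubini') measurable
  ultimately show ?thesis using interaction_le[OF assms] by simp
qed

section \<open>Compactness\<close>

lemma bounded_obtain_cball:
  fixes S :: "'a::real_normed_vector set"
  assumes "bounded S"
  obtains R where "S \<subseteq> cball 0 R"
proof -
  obtain R where "\<forall>x\<in>S. norm x \<le> R" using assms by (auto simp: bounded_iff)
  then show thesis by (intro that[of R]) auto
qed

lemma emeasure_lborel_cball_finite:
  "emeasure lborel (cball (c::'a::euclidean_space) r) < top"
  using emeasure_bounded_finite[OF bounded_cball] by simp

lemma measure_ball_pos:
  fixes c :: "'a::euclidean_space"
  assumes "0 < r"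
  shows "0 < measure lborel (ball c r)"
  using assms by (simp add: content_ball)

lemma emeasure_finite_mono:
  assumes "A \<subseteq> B" "B \<in> sets M" "emeasure M B < \<infinity>"
  shows "emeasure M A < \<infinity>"
  using emeasure_mono[OF assms(1,2)] assms(3) by (rule le_less_trans)

text \<open>Takes the place of an isoperimetric inequality. If \<open>E\<close> fills at most half
  the volume of an \<open>r\<close>-ball, then every point of \<open>E\<close> misses at least half
  of its ball, and \<open>interaction_inner_le\<close> limits the total that can be missed.\<close>

lemma measure_le_of_perimeter_le:
  fixes E :: "'a::euclidean_space set"
  assumes E: "E \<in> sets borel" "emeasure lborel E < \<infinity>" and P: "perimeter E \<le> ereal C"
    and r: "0 < r" "2 * measure lborel E \<le> measure lborel (ball (0::'a) r)"
  shows "measure lborel E \<le> 2 * r * C"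
proof -
  note E(1)[measurable]
  define b where "b = measure lborel (ball (0::'a) r)"
  have b: "0 < b" "\<And>x::'a. measure lborel (ball x r) = b"
    using r(1) by (simp_all add: b_def content_ball)
  have eE: "emeasure lborel E = ennreal (measure lborel E)"
    using E(2) by (intro emeasure_eq_ennreal_measure) auto
  have "ennreal (b / 2) \<le> emeasure lborel (ball x r - E)" for x
  proof -
    have f: "emeasure lborel (ball x r - E) < \<infinity>"
      by (rule emeasure_finite_mono[of _ "ball x r"]) (use r(1) in \<open>auto simp: emeasure_ball\<close>)
    have "measure lborel (ball x r) \<le> measure lborel ((ball x r - E) \<union> E)"
    proof (rule measure_mono_fmeasurable)
      show "ball x r - E \<union> E \<in> fmeasurable lborel"
        using E f by (intro fmeasurable.Un fmeasurableI) simp_all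
    qed auto
    also have "\<dots> \<le> measure lborel (ball x r - E) + measure lborel E"
      by (rule measure_Un_le) auto
    finally have "b / 2 \<le> measure lborel (ball x r - E)" using r(2)[folded b_def] by (simp add: b(2))
    then have "ennreal (b / 2) \<le> ennreal (measure lborel (ball x r - E))" by (rule ennreal_leI)
    also have "\<dots> = emeasure lborel (ball x r - E)"
      using f by (intro emeasure_eq_ennreal_measure[symmetric]) auto
    finally show ?thesis .
  qed
  then have "(\<integral>\<^sup>+x. ennreal (b / 2) * indicator E x \<partial>lborel) \<le>
      (\<integral>\<^sup>+x. indicator E x * emeasure lborel (ball x r - E) \<partial>lborel)"
    by (intro nn_integral_mono) (simp add: indicator_def)
  also have "\<dots> \<le> ennreal (r * C) * emeasure lborel (ball (0::'a) r)"
    by (rule interaction_inner_le) (use assms in auto)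
  also have "emeasure lborel (ball (0::'a) r) = ennreal b"
    using r(1) by (simp add: b_def emeasure_ball content_ball)
  also have "(\<integral>\<^sup>+x. ennreal (b / 2) * indicator E x \<partial>lborel) = ennreal (b / 2) * emeasure lborel E"
    by (rule nn_integral_cmult_indicator) simp
  finally have "b / 2 * measure lborel E \<le> r * C * b"
    using b(1) r(1) perimeter_bound_nonneg[OF P] by (simp add: eE ennreal_mult'[symmetric] ennreal_le_iff)
  then have "b * measure lborel E \<le> b * (2 * r * C)" by (simp add: algebra_simps)
  then show ?thesis using b(1) by simp
qed

text \<open>A set of smaller measure would satisfy \<open>measure_le_of_perimeter_le\<close> with
  \<open>C = K * measure lborel E\<close>, that is, its measure would be at most
  \<open>2 * r * K\<close> times itself. The radius is chosen to make this factor less than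
  1.\<close>

lemma measure_ge_of_ratio_le:
  fixes E :: "'a::euclidean_space set"
  assumes E: "E \<in> sets borel" "emeasure lborel E < \<infinity>" "0 < measure lborel E"
    and P: "perimeter E \<le> ereal (K * measure lborel E)"
  shows "measure lborel (ball (0::'a) (1 / (4 * (\<bar>K\<bar> + 1)))) / 2 \<le> measure lborel E"
proof (rule ccontr)
  define r where "r = 1 / (4 * (\<bar>K\<bar> + 1))"
  have r: "0 < r" by (simp add: r_def)
  assume "\<not> ?thesis"
  then have "2 * measure lborel E \<le> measure lborel (ball (0::'a) r)" by (simp add: r_def)
  from measure_le_of_perimeter_le[OF E(1,2) P r this]
  have "measure lborel E * 1 \<le> measure lborel E * (2 * r * K)" by (simp add: algebra_simps)
  then have "1 \<le> 2 * r * K" using E(3) by (simp only: mult_le_cancel_left_pos)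
  moreover have "2 * r * K < 1" unfolding r_def by (simp add: field_simps)
  ultimately show False by simp
qed

text \<open>The averages of \<open>E\<close> and \<open>F\<close> over small balls are nearly constant on a finer scale, so
  they need to be compared only at the points of a net.\<close>

lemma measure_diff_le_net:
  fixes E F :: "'a::euclidean_space set"
  assumes E: "E \<in> sets borel" "emeasure lborel E < \<infinity>" "perimeter E \<le> ereal C"
    and F: "F \<in> sets borel" "emeasure lborel F < \<infinity>" "perimeter F \<le> ereal C"
    and r: "0 < r" and "0 \<le> \<delta>"
    and net: "\<And>x. x \<in> E \<Longrightarrow> \<exists>p. dist p x < r \<and>
      measure lborel (E \<inter> ball p (2 * r)) \<le> measure lborel (F \<inter> ball p (2 * r)) + \<delta>"
  shows "measure lborel (ball (0::'a) r) * measure lborel (E - F) \<le>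
    r * C * measure lborel (ball (0::'a) r) + 3 * r * C * measure lborel (ball (0::'a) (3 * r))
    + \<delta> * measure lborel E"
proof -
  note E(1)[measurable] F(1)[measurable]
  define b where "b = measure lborel (ball (0::'a) r)"
  define b3 where "b3 = measure lborel (ball (0::'a) (3 * r))"
  have b: "0 < b" "\<And>x::'a. emeasure lborel (ball x r) = ennreal b"
      "emeasure lborel (ball (0::'a) (3 * r)) = ennreal b3" "0 < b3"
    using r by (simp_all add: b_def b3_def emeasure_ball content_ball)
  have C: "0 \<le> C" using perimeter_bound_nonneg[OF E(3)] .
  have fin: "emeasure lborel (A \<inter> B) = ennreal (measure lborel (A \<inter> B))"
    if "emeasure lborel A < \<infinity>" "A \<in> sets borel" for A B :: "'a set"
    using emeasure_finite_mono[of "A \<inter> B" A lborel] that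
    by (intro emeasure_eq_ennreal_measure) auto
  have ball: "ball x s = {y. dist x y < s}" for x :: 'a and s by (auto simp: ball_def)
  have [measurable]: "(\<lambda>x. emeasure lborel (ball x r - E)) \<in> borel_measurable borel"
    "(\<lambda>x. emeasure lborel (F \<inter> ball x (3 * r))) \<in> borel_measurable borel"
    unfolding ball by measurable
  \<comment> \<open>The radii grow by \<open>r\<close> with each change of centre: the part of
    \<open>E\<close> in \<open>ball x r\<close> lies in \<open>ball p (2 * r)\<close>, where
    \<open>E\<close> and \<open>F\<close> are compared, and that ball lies in
    \<open>ball x (3 * r)\<close>. Hence a point of \<open>E - F\<close> pays either with volume
    missing from \<open>E\<close> or with volume of \<open>F\<close> near a point outside
    \<open>F\<close>.\<close>
  have "ennreal b * indicator (E - F) x \<le> indicator E x * emeasure lborel (ball x r - E)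
      + indicator (-F) x * emeasure lborel (F \<inter> ball x (3 * r)) + ennreal \<delta> * indicator E x" for x
  proof (cases "x \<in> E - F")
    case True
    then obtain p where p: "dist p x < r"
      "measure lborel (E \<inter> ball p (2 * r)) \<le> measure lborel (F \<inter> ball p (2 * r)) + \<delta>"
      using net by blast
    have 1: "ball x r \<inter> E \<subseteq> E \<inter> ball p (2 * r)" "F \<inter> ball p (2 * r) \<subseteq> F \<inter> ball x (3 * r)"
      using p(1) by (auto simp: dist_commute) (metric+)
    have "ennreal b = emeasure lborel (ball x r)" by (simp add: b)
    also have "\<dots> \<le> emeasure lborel ((ball x r - E) \<union> (ball x r \<inter> E))"
      by (intro emeasure_mono) auto
    also have "\<dots> \<le> emeasure lborel (ball x r - E) + emeasure lborel (ball x r \<inter> E)"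
      by (rule emeasure_subadditive) auto
    also have "emeasure lborel (ball x r \<inter> E) \<le> emeasure lborel (E \<inter> ball p (2 * r))"
      by (intro emeasure_mono 1) auto
    also have "\<dots> \<le> emeasure lborel (F \<inter> ball p (2 * r)) + ennreal \<delta>"
      using p(2) E F \<open>0 \<le> \<delta>\<close> by (simp add: fin ennreal_plus[symmetric] ennreal_leI del: ennreal_plus)
    also have "emeasure lborel (F \<inter> ball p (2 * r)) \<le> emeasure lborel (F \<inter> ball x (3 * r))"
      by (intro emeasure_mono 1) auto
    finally show ?thesis using True by (simp add: add.assoc add_mono)
  qed simp
  then have "(\<integral>\<^sup>+x. ennreal b * indicator (E - F) x \<partial>lborel) \<le>
     (\<integral>\<^sup>+x. indicator E x * emeasure lborel (ball x r - E)
      + indicator (-F) x * emeasure lborel (F \<inter> ball x (3 * r)) + ennreal \<delta> * indicator E x \<partial>lborel)"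
    by (intro nn_integral_mono)
  also have "\<dots> = (\<integral>\<^sup>+x. indicator E x * emeasure lborel (ball x r - E) \<partial>lborel)
      + (\<integral>\<^sup>+x. indicator (-F) x * emeasure lborel (F \<inter> ball x (3 * r)) \<partial>lborel)
      + ennreal \<delta> * emeasure lborel E"
    by (subst nn_integral_add, measurable, subst nn_integral_add, measurable)
       (simp add: nn_integral_cmult_indicator)
  also have "\<dots> \<le> ennreal (r * C) * ennreal b + ennreal (3 * r * C) * ennreal b3 + ennreal \<delta> * emeasure lborel E"
    using interaction_inner_le[OF E, of r] interaction_outer_le[OF F, of "3 * r"] r
    by (intro add_mono) (simp_all add: b)
  also have "(\<integral>\<^sup>+x. ennreal b * indicator (E - F) x \<partial>lborel) = ennreal b * emeasure lborel (E \<inter> - F)"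
    by (subst nn_integral_cmult_indicator) (auto simp: Diff_eq)
  also have "\<dots> = ennreal (b * measure lborel (E - F))"
    using b by (simp add: fin[OF E(2,1)] ennreal_mult Diff_eq)
  also have "emeasure lborel E = ennreal (measure lborel E)"
    using fin[OF E(2,1), of UNIV] by simp
  finally have "b * measure lborel (E - F) \<le> r * C * b + 3 * r * C * b3 + \<delta> * measure lborel E"
    using r C b \<open>0 \<le> \<delta>\<close> by (simp flip: ennreal_mult ennreal_plus)
  then show ?thesis by (simp add: b_def b3_def)
qed

section \<open>Subsequences convergent in measure and almost everywhere\<close>

text \<open>Tychonoff in place of a diagonal argument; countability of the index type turns
  compactness of the product into sequential compactness.\<close>

lemma seq_compact_real_box:
  fixes f :: "nat \<Rightarrow> 'i::countable \<Rightarrow> real"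
  assumes "\<And>n i. 0 \<le> f n i" "\<And>n i. f n i \<le> M"
  obtains l s where "strict_mono (s :: nat \<Rightarrow> nat)" "\<And>i. (\<lambda>n. f (s n) i) \<longlonglongrightarrow> l i"
proof -
  have "compactin (product_topology (\<lambda>i::'i. euclidean) UNIV) (PiE UNIV (\<lambda>i. {0..M}))"
    by (subst compactin_PiE) auto
  then have "seq_compact (PiE UNIV (\<lambda>i::'i. {0..M}))"
    by (simp add: euclidean_product_topology compact_imp_seq_compact)
  moreover have "\<forall>n. f n \<in> PiE UNIV (\<lambda>i. {0..M})" using assms by auto
  ultimately obtain l s where s: "strict_mono (s :: nat \<Rightarrow> nat)" and l: "(f \<circ> s) \<longlonglongrightarrow> l"
    by (rule seq_compactE)
  have "(\<lambda>n. (f \<circ> s) n i) \<longlonglongrightarrow> l i" for i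
    using continuous_on_tendsto_compose[OF continuous_on_product_coordinates l] by auto
  with s show thesis by (intro that[of s l]) auto
qed

text \<open>Along a subsequence the volumes in countably many balls all converge. For a given
  accuracy only finitely many of these balls are needed, because a bounded set has a finite net, and
  \<open>measure_diff_le_net\<close> applies. One-sided differences suffice, as \<open>a\<close> and
  \<open>b\<close> may be exchanged.\<close>

lemma Cauchy_subsequence_of_perimeter_le:
  fixes E :: "nat \<Rightarrow> nat \<Rightarrow> 'a::euclidean_space set"
  assumes "bounded \<Omega>"
    and E: "\<And>n i. i < k \<Longrightarrow> E n i \<in> sets borel" "\<And>n i. i < k \<Longrightarrow> E n i \<subseteq> \<Omega>"
    and P: "\<And>n i. i < k \<Longrightarrow> perimeter (E n i) \<le> ereal C"
  obtains s where "strict_mono (s :: nat \<Rightarrow> nat)"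
    "\<And>e. 0 < e \<Longrightarrow> \<exists>N. \<forall>a\<ge>N. \<forall>b\<ge>N. \<forall>i<k. measure lborel (E (s a) i - E (s b) i) < e"
proof -
  obtain R where R: "\<Omega> \<subseteq> cball 0 R"
    using bounded_obtain_cball[OF \<open>bounded \<Omega>\<close>] by blast
  define M where "M = measure lborel (cball (0::'a) R)"
  obtain D :: "'a set" where D: "countable D" "\<And>X. open X \<Longrightarrow> X \<noteq> {} \<Longrightarrow> \<exists>d\<in>D. d \<in> X"
    using countable_dense_setE by blast
  then have "D \<noteq> {}" using open_UNIV by blast
  define p where "p = from_nat_into D"
  have range_p: "range p = D"
    unfolding p_def using D(1) \<open>D \<noteq> {}\<close> by (simp add: range_from_nat_into)
  have fin: "emeasure lborel (E n i) < \<infinity>" if "i < k" for n i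
    by (rule emeasure_finite_mono[of _ "cball 0 R"])
       (use E[OF that] R in \<open>auto simp: emeasure_lborel_cball_finite\<close>)
  have M: "measure lborel (E n i \<inter> B) \<le> M" if "i < k" "B \<in> sets borel" for n i B
    unfolding M_def by (rule measure_mono_fmeasurable)
      (use E[OF that(1)] R that(2) in \<open>auto intro!: fmeasurableI simp: emeasure_lborel_cball_finite\<close>)
  have "0 \<le> M" by (simp add: M_def)
  \<comment> \<open>The index consists of component, centre and scale. The radius is twice the mesh
    \<open>1 / Suc m\<close> of the net, as \<open>measure_diff_le_net\<close> requires.\<close>
  define V where "V n = (\<lambda>(i, j, m). if i < k
    then measure lborel (E n i \<inter> ball (p j) (2 / real (Suc m))) else 0)" for n
  have "0 \<le> V n z" "V n z \<le> M" for n z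
    unfolding V_def using M \<open>0 \<le> M\<close> by (auto split: prod.splits)
  then obtain l s where s: "strict_mono (s :: nat \<Rightarrow> nat)" and l: "\<And>z. (\<lambda>n. V (s n) z) \<longlonglongrightarrow> l z"
    by (rule seq_compact_real_box[of V M]) (rule that)
  have "\<exists>N. \<forall>a\<ge>N. \<forall>b\<ge>N. \<forall>i<k. measure lborel (E (s a) i - E (s b) i) < e" if "0 < e" for e
  proof -
    define d where "d = DIM('a)"
    \<comment> \<open>After division by the volume \<open>b\<close> of an \<open>r\<close>-ball, the
      two perimeter terms of \<open>measure_diff_le_net\<close> amount to at most
      \<open>r * C'\<close>, because a ball of radius \<open>3 * r\<close> has volume
      \<open>3 ^ d * b\<close>.\<close>
    define C' where "C' = \<bar>C\<bar> * (1 + 3 * 3 ^ d)"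
    have "0 \<le> C'" by (simp add: C'_def)
    obtain m where m: "inverse (real (Suc m)) < e / (2 * (C' + 1))"
      using reals_Archimedean[of "e / (2 * (C' + 1))"] \<open>0 < e\<close> \<open>0 \<le> C'\<close> by auto
    define r where "r = inverse (real (Suc m))"
    have r: "0 < r" "r * C' < e / 2"
    proof -
      show "0 < r" by (simp add: r_def)
      have "r * C' \<le> r * (C' + 1)" using \<open>0 < r\<close> by simp
      also have "\<dots> < e / (2 * (C' + 1)) * (C' + 1)"
        using m \<open>0 \<le> C'\<close> by (intro mult_strict_right_mono) (auto simp: r_def)
      also have "\<dots> = e / 2" using \<open>0 \<le> C'\<close> by (simp add: field_simps)
      finally show "r * C' < e / 2" .
    qed
    define b where "b = measure lborel (ball (0::'a) r)"
    have b: "0 < b" "measure lborel (ball (0::'a) (3 * r)) = 3 ^ d * b"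
      using r(1) by (simp_all add: b_def content_ball d_def power_mult_distrib)
    \<comment> \<open>Half of the error \<open>e\<close> is reserved for the perimeter terms, by the
      choice of \<open>r\<close>, and half for the comparison at the net; \<open>M + 1\<close>
      avoids division by zero.\<close>
    define \<delta> where "\<delta> = e * b / (2 * (M + 1))"
    have \<delta>: "0 < \<delta>" "\<delta> * M \<le> e / 2 * b"
      using \<open>0 < e\<close> b(1) \<open>0 \<le> M\<close> by (simp_all add: \<delta>_def field_simps)
    have "cball 0 R \<subseteq> (\<Union>j\<in>UNIV. ball (p j) r)"
    proof
      fix x :: 'a assume "x \<in> cball 0 R"
      obtain q where "q \<in> D" "q \<in> ball x r"
        using D(2)[of "ball x r"] r(1) by auto
      then show "x \<in> (\<Union>j\<in>UNIV. ball (p j) r)"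
        using range_p by (auto simp: dist_commute image_iff)
    qed
    then obtain J where J: "finite J" "cball (0::'a) R \<subseteq> (\<Union>j\<in>J. ball (p j) r)"
      using compactE_image[OF compact_cball, of UNIV "\<lambda>j. ball (p j) r" 0 R] by auto
    have "\<forall>\<^sub>F n in sequentially. \<forall>z\<in>{..<k} \<times> J \<times> {m}. \<bar>V (s n) z - l z\<bar> < \<delta> / 2"
      using J(1) tendstoD[OF l, of "\<delta> / 2"] \<delta>(1)
      by (intro eventually_ball_finite) (auto simp: dist_real_def)
    then obtain N where N: "\<And>n z. N \<le> n \<Longrightarrow> z \<in> {..<k} \<times> J \<times> {m} \<Longrightarrow> \<bar>V (s n) z - l z\<bar> < \<delta> / 2"
      unfolding eventually_sequentially by blast
    have "measure lborel (E (s a) i - E (s b') i) < e" if a: "N \<le> a" "N \<le> b'" "i < k" for a b' i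
    proof -
      have r2: "2 * r = 2 / real (Suc m)" by (simp add: r_def field_simps)
      have "b * measure lborel (E (s a) i - E (s b') i) \<le>
          r * C * b + 3 * r * C * measure lborel (ball (0::'a) (3 * r)) + \<delta> * measure lborel (E (s a) i)"
        unfolding b_def
      proof (rule measure_diff_le_net)
        fix x assume "x \<in> E (s a) i"
        then have "x \<in> (\<Union>j\<in>J. ball (p j) r)" using E(2)[OF a(3)] R J(2) by blast
        then obtain j where j: "j \<in> J" "dist (p j) x < r" by auto
        have "\<bar>V (s a) (i, j, m) - l (i, j, m)\<bar> < \<delta> / 2" "\<bar>V (s b') (i, j, m) - l (i, j, m)\<bar> < \<delta> / 2"
          by (rule N[OF a(1)], use j(1) a(3) in simp, rule N[OF a(2)], use j(1) a(3) in simp)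
        then have "V (s a) (i, j, m) \<le> V (s b') (i, j, m) + \<delta>" by linarith
        then show "\<exists>p. dist p x < r \<and> measure lborel (E (s a) i \<inter> ball p (2 * r)) \<le>
            measure lborel (E (s b') i \<inter> ball p (2 * r)) + \<delta>"
          using j(2) a(3) unfolding r2 by (intro exI[of _ "p j"]) (simp add: V_def)
      qed (use E(1)[OF a(3)] P[OF a(3)] fin[OF a(3)] r(1) \<delta>(1) in simp_all)
      also have "\<dots> \<le> r * \<bar>C\<bar> * b + 3 * r * \<bar>C\<bar> * (3 ^ d * b) + \<delta> * M"
        using r(1) b \<delta>(1) M[OF a(3), of UNIV "s a"]
        by (intro add_mono mult_right_mono mult_left_mono) auto
      also have "\<dots> = b * (r * C') + \<delta> * M" by (simp add: C'_def algebra_simps)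
      also have "\<dots> < b * (e / 2) + e / 2 * b"
        using r(2) b(1) \<delta>(2) by (intro add_less_le_mono mult_strict_left_mono)
      finally have "b * measure lborel (E (s a) i - E (s b') i) < b * e" by (simp add: algebra_simps)
      then show ?thesis using b(1) by simp
    qed
    then show ?thesis by blast
  qed
  with s show thesis by (rule that)
qed

text \<open>Differences of measure below \<open>(1/2)^n\<close> are summable, so by Borel-Cantelli
  almost every point changes membership only finitely often. The limit is named as the set of points
  that lie eventually in the sequence, because inclusions and disjointness then pass to it at every
  point.\<close>

lemma convergent_subsequence_of_perimeter_le:
  fixes E :: "nat \<Rightarrow> nat \<Rightarrow> 'a::euclidean_space set"
  assumes "bounded \<Omega>"
    and E: "\<And>n i. i < k \<Longrightarrow> E n i \<in> sets borel" "\<And>n i. i < k \<Longrightarrow> E n i \<subseteq> \<Omega>"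
    and P: "\<And>n i. i < k \<Longrightarrow> perimeter (E n i) \<le> ereal C"
  obtains s where "strict_mono (s :: nat \<Rightarrow> nat)"
    "\<And>i. i < k \<Longrightarrow> AE x in lborel. \<forall>\<^sub>F n in sequentially.
        x \<in> E (s n) i \<longleftrightarrow> (\<forall>\<^sub>F m in sequentially. x \<in> E (s m) i)"
proof -
  obtain s where s: "strict_mono (s :: nat \<Rightarrow> nat)" and Cauchy:
    "\<And>e. 0 < e \<Longrightarrow> \<exists>N. \<forall>a\<ge>N. \<forall>b\<ge>N. \<forall>i<k. measure lborel (E (s a) i - E (s b) i) < e"
    by (rule Cauchy_subsequence_of_perimeter_le[of \<Omega> k E C, OF assms]) (assumption+, rule that)
  have "\<exists>N. \<forall>a\<ge>N. \<forall>b\<ge>N. \<forall>i<k. measure lborel (E (s a) i - E (s b) i) < (1/2)^n" for n :: nat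
    by (rule Cauchy) simp
  then obtain N where N: "\<And>n a b i. N n \<le> a \<Longrightarrow> N n \<le> b \<Longrightarrow> i < k \<Longrightarrow>
      measure lborel (E (s a) i - E (s b) i) < (1/2)^n"
    by metis
  \<comment> \<open>Dominates \<open>N n\<close>, and the summand \<open>n\<close> makes it strictly
    increasing.\<close>
  define t where "t n = n + sum N {..n}" for n
  have t: "strict_mono t" unfolding t_def strict_mono_Suc_iff by simp
  have Nt: "N n \<le> t n" for n
    using member_le_sum[of n "{..n}" N] by (simp add: t_def)
  define u where "u = s \<circ> t"
  obtain R where R: "\<Omega> \<subseteq> cball 0 R"
    using bounded_obtain_cball[OF \<open>bounded \<Omega>\<close>] by blast
  have "AE x in lborel. \<forall>\<^sub>F n in sequentially. x \<in> E (u n) i \<longleftrightarrow> (\<forall>\<^sub>F m in sequentially. x \<in> E (u m) i)"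
    if i: "i < k" for i
  proof -
    define A where "A n = (E (u n) i - E (u (Suc n)) i) \<union> (E (u (Suc n)) i - E (u n) i)" for n
    have m: "A n \<in> sets lborel" "A n \<subseteq> cball 0 R" for n
      unfolding A_def using E[OF i] R by auto
    have "measure lborel (A n) \<le> 2 * (1/2)^n" for n
    proof -
      have "t n \<le> t (Suc n)" using t by (simp add: strict_mono_less_eq)
      then have "measure lborel (E (u n) i - E (u (Suc n)) i) < (1/2)^n"
        "measure lborel (E (u (Suc n)) i - E (u n) i) < (1/2)^n"
        unfolding u_def comp_def by (intro N i Nt order_trans[OF Nt]; simp)+
      moreover have "measure lborel (A n) \<le> measure lborel (E (u n) i - E (u (Suc n)) i)
          + measure lborel (E (u (Suc n)) i - E (u n) i)"
        unfolding A_def using E[OF i] by (intro measure_Un_le) auto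
      ultimately show ?thesis by simp
    qed
    then have le: "norm (measure lborel (A n)) \<le> 2 * (1/2)^n" for n
      by (simp only: real_norm_def abs_of_nonneg[OF measure_nonneg])
    have "summable (\<lambda>n. 2 * (1/2::real)^n)"
      by (rule summable_mult, rule summable_geometric) simp
    then have "summable (\<lambda>n. measure lborel (A n))"
      by (rule summable_comparison_test'[where N = 0]) (rule le)
    moreover have "emeasure lborel (A n) < \<infinity>" for n
      by (rule emeasure_finite_mono[OF m(2)]) (auto simp: emeasure_lborel_cball_finite)
    ultimately have "AE x in lborel. \<forall>\<^sub>F n in sequentially. x \<in> space lborel - A n"
      by (intro borel_cantelli_AE1 m)
    then show ?thesis
    proof eventually_elim
      case (elim x)
      then obtain n0 where n0: "\<And>n. n0 \<le> n \<Longrightarrow> x \<notin> A n" unfolding eventually_sequentially by auto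
      have const: "x \<in> E (u n) i \<longleftrightarrow> x \<in> E (u n0) i" if "n0 \<le> n" for n
        using that
      proof (induction rule: dec_induct)
        case (step n)
        then show ?case using n0[of n] by (auto simp: A_def)
      qed simp
      then have "(\<forall>\<^sub>F m in sequentially. x \<in> E (u m) i) \<longleftrightarrow> x \<in> E (u n0) i"
        unfolding eventually_sequentially by (meson nle_le order_trans)
      with const show ?case unfolding eventually_sequentially by blast
    qed
  qed
  moreover have "strict_mono u" unfolding u_def using s t by (rule strict_mono_o)
  ultimately show thesis using that by blast
qed

section \<open>Lower semicontinuity of the Cheeger ratio\<close>

lemma cheeger_ratio_cong_AE:
  fixes A B :: "'a::euclidean_space set"
  assumes A: "A \<in> sets lebesgue" "B \<in> sets lebesgue" and AE: "AE x in lebesgue. x \<in> A \<longleftrightarrow> x \<in> B"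
  shows "emeasure lebesgue A = emeasure lebesgue B" "cheeger_ratio A = cheeger_ratio B"
proof -
  show "emeasure lebesgue A = emeasure lebesgue B" by (rule emeasure_eq_AE[OF AE A])
  have "(LINT x:A|lebesgue. divergence \<phi> x) = (LINT x:B|lebesgue. divergence \<phi> x)"
    if "\<phi> \<in> test_fields" for \<phi>
  proof -
    have "divergence \<phi> \<in> borel_measurable lebesgue"
      using borel_measurable_continuous_onI[OF divergence_test_field(1)[OF that]]
      by (intro measurable_completion) simp
    then show ?thesis
      unfolding set_lebesgue_integral_def
      by (intro integral_cong_AE borel_measurable_scaleR borel_measurable_indicator A)
         (use AE in \<open>auto elim!: eventually_mono simp: indicator_def\<close>)
  qed
  then have "perimeter A = perimeter B" unfolding perimeter_def by (intro SUP_cong) auto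
  moreover have "measure lebesgue A = measure lebesgue B" by (rule measure_eq_AE[OF AE A])
  ultimately show "cheeger_ratio A = cheeger_ratio B" by (simp add: cheeger_ratio_def)
qed

text \<open>The Borel set is taken inside \<open>A\<close>, so that replacing the members of a tuple
  keeps them disjoint and inside \<Omega>.\<close>

lemma borel_core:
  fixes A :: "'a::euclidean_space set"
  assumes "A \<in> sets lebesgue"
  obtains B where "B \<in> sets borel" "B \<subseteq> A" "emeasure lebesgue A = emeasure lebesgue B"
    "cheeger_ratio A = cheeger_ratio B"
proof -
  obtain S N N' where *: "A = S \<union> N" "N \<subseteq> N'" "N' \<in> null_sets lborel" "S \<in> sets lborel"
    using sets_completionE[OF assms] by metis
  have "AE x in lborel. x \<notin> N'" using *(3) by (rule AE_not_in)
  then have "AE x in lebesgue. x \<in> A \<longleftrightarrow> x \<in> S"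
    using *(1,2) by (intro AE_completion) (auto elim!: eventually_mono)
  from cheeger_ratio_cong_AE[OF assms _ this] show thesis
    using * by (intro that[of S]) auto
qed

lemma tendsto_set_integral_of_AE_eventually:
  fixes f :: "'a::euclidean_space \<Rightarrow> real"
  assumes E: "\<And>n. E n \<in> sets borel" "\<And>n. E n \<subseteq> cball 0 R" "F \<in> sets borel"
    and AE: "AE x in lborel. \<forall>\<^sub>F n in sequentially. x \<in> E n \<longleftrightarrow> x \<in> F"
    and f: "f \<in> borel_measurable borel" "\<And>x. \<bar>f x\<bar> \<le> B"
  shows "(\<lambda>n. LINT x:E n|lborel. f x) \<longlonglongrightarrow> (LINT x:F|lborel. f x)"
  unfolding set_lebesgue_integral_def
proof (rule integral_dominated_convergence)
  note E(1,3)[measurable] f(1)[measurable]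
  show "(\<lambda>x. indicat_real F x *\<^sub>R f x) \<in> borel_measurable lborel" by measurable
  show "(\<lambda>x. indicat_real (E n) x *\<^sub>R f x) \<in> borel_measurable lborel" for n by measurable
  show "integrable lborel (\<lambda>x. B * indicator (cball (0::'a) R) x)"
    using emeasure_lborel_cball_finite
    by (intro integrable_mult_right integrable_real_indicator) auto
  show "AE x in lborel. (\<lambda>n. indicat_real (E n) x *\<^sub>R f x) \<longlonglongrightarrow> indicat_real F x *\<^sub>R f x"
    using AE
  proof eventually_elim
    case (elim x)
    show ?case
      by (rule tendsto_eventually) (use elim in \<open>auto elim!: eventually_mono simp: indicator_def\<close>)
  qed
  show "AE x in lborel. norm (indicat_real (E n) x *\<^sub>R f x) \<le> B * indicator (cball 0 R) x" for n
    using E(2)[of n] f(2) order_trans[OF abs_ge_zero f(2)] by (intro AE_I2) (auto simp: indicator_def)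
qed

lemma measure_lebesgue_eq_lborel:
  "A \<in> sets borel \<Longrightarrow> measure lebesgue A = measure lborel A"
  by (simp add: measure_completion)

text \<open>For one fixed test field, the integral of its divergence divided by the volume
  converges, since the limit volume is at least \<open>d\<close>. Each such quotient is below the
  ratio, and the supremum over all fields on the limit side yields the bound.\<close>

lemma cheeger_ratio_le_Liminf:
  fixes E :: "nat \<Rightarrow> 'a::euclidean_space set"
  assumes E: "\<And>n. E n \<in> sets borel" "\<And>n. E n \<subseteq> cball 0 R" "F \<in> sets borel"
    and AE: "AE x in lborel. \<forall>\<^sub>F n in sequentially. x \<in> E n \<longleftrightarrow> x \<in> F"
    and pos: "\<And>n. d \<le> measure lborel (E n)" "0 < d"
  shows "d \<le> measure lborel F"
    "cheeger_ratio F \<le> liminf (\<lambda>n. cheeger_ratio (E n))"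
proof -
  have "(\<lambda>n. LINT x:E n|lborel. (1::real)) \<longlonglongrightarrow> (LINT x:F|lborel. 1)"
    by (rule tendsto_set_integral_of_AE_eventually[OF E AE, where B = 1 and f = "\<lambda>x. 1"]) auto
  then have m: "(\<lambda>n. measure lborel (E n)) \<longlonglongrightarrow> measure lborel F"
    using E by (simp add: set_lebesgue_integral_def)
  then show F: "d \<le> measure lborel F" using pos(1) LIMSEQ_le_const by blast
  let ?L = "liminf (\<lambda>n. cheeger_ratio (E n))"
  have mE: "measure lebesgue (E n) = measure lborel (E n)" "0 < measure lborel (E n)" for n
    using E pos(2) pos(1)[of n] by (simp_all add: measure_lebesgue_eq_lborel)
  have mF: "measure lebesgue F = measure lborel F" "0 < measure lborel F"
    using E pos(2) F by (simp_all add: measure_lebesgue_eq_lborel)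
  have "ereal (LINT x:F|lebesgue. divergence \<phi> x) \<le> ereal (measure lborel F) * ?L"
    if \<phi>: "\<phi> \<in> test_fields" for \<phi>
  proof -
    let ?I = "\<lambda>A. LINT x:A|lborel. divergence \<phi> x"
    have meas: "divergence \<phi> \<in> borel_measurable borel"
      using divergence_test_field(1)[OF \<phi>] by (rule borel_measurable_continuous_onI)
    obtain B where B: "\<And>x. \<bar>divergence \<phi> x\<bar> \<le> B" using divergence_test_field(2)[OF \<phi>] by blast
    have I: "ereal (?I (E n)) \<le> perimeter (E n)" for n
      unfolding perimeter_def set_integral_lebesgue_eq_lborel[OF E(1) meas, symmetric]
      by (rule SUP_upper[OF \<phi>])
    have "(\<lambda>n. ?I (E n) / measure lborel (E n)) \<longlonglongrightarrow> ?I F / measure lborel F"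
      using tendsto_set_integral_of_AE_eventually[OF E AE meas B] m mF by (intro tendsto_divide) auto
    then have "(\<lambda>n. ereal (?I (E n) / measure lborel (E n))) \<longlonglongrightarrow> ereal (?I F / measure lborel F)"
      by simp
    then have "ereal (?I F / measure lborel F) = liminf (\<lambda>n. ereal (?I (E n) / measure lborel (E n)))"
      by (intro lim_imp_Liminf[symmetric]) auto
    also have "\<dots> \<le> ?L"
    proof (intro Liminf_mono always_eventually allI)
      fix n
      have "ereal (?I (E n)) / ereal (measure lborel (E n)) \<le> perimeter (E n) / ereal (measure lborel (E n))"
        using I mE(2) by (intro ereal_divide_right_mono) auto
      then show "ereal (?I (E n) / measure lborel (E n)) \<le> cheeger_ratio (E n)"
        using mE[of n] by (simp add: cheeger_ratio_def)
    qed
    finally have "ereal (?I F) / ereal (measure lborel F) \<le> ?L" using mF by simp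
    then have "ereal (?I F) \<le> ereal (measure lborel F) * ?L"
      using mF by (subst (asm) ereal_divide_le_pos) auto
    then show ?thesis by (simp add: set_integral_lebesgue_eq_lborel[OF E(3) meas])
  qed
  then have "perimeter F \<le> ereal (measure lborel F) * ?L"
    unfolding perimeter_def by (rule SUP_least)
  then show "cheeger_ratio F \<le> ?L"
    using mF unfolding cheeger_ratio_def by (subst ereal_divide_le_pos) auto
qed

text \<open>A bound on the ratios bounds the perimeters, since the volumes are bounded in
  \<open>cball 0 R\<close>, and also keeps the volumes away from 0. The first gives convergence, the
  second a limit tuple whose members have positive measure.\<close>

lemma admissible_tuples_seq_compact:
  fixes \<Omega> :: "'a::euclidean_space set"
  assumes "bounded \<Omega>"
    and E: "\<And>n. E n \<in> admissible_tuples k \<Omega>"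
    and ratio: "\<And>n i. i < k \<Longrightarrow> cheeger_ratio (E n i) \<le> ereal K"
  obtains s F where "strict_mono (s :: nat \<Rightarrow> nat)" "F \<in> admissible_tuples k \<Omega>"
    "\<And>i. i < k \<Longrightarrow> cheeger_ratio (F i) \<le> liminf (\<lambda>n. cheeger_ratio (E (s n) i))"
proof -
  obtain R where R: "\<Omega> \<subseteq> cball 0 R"
    by (rule bounded_obtain_cball[OF \<open>bounded \<Omega>\<close>])
  have E': "E n i \<in> sets lebesgue" "E n i \<subseteq> \<Omega>" "0 < emeasure lebesgue (E n i)"
    if "i < k" for n i
    using E[of n] that by (auto simp: admissible_tuples_def)
  have E_disj: "E n i \<inter> E n j = {}" if "i < k" "j < k" "i \<noteq> j" for n i j
    using E[of n] that by (auto simp: admissible_tuples_def)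
  have "\<exists>B. B \<in> sets borel \<and> B \<subseteq> E n i \<and> emeasure lebesgue (E n i) = emeasure lebesgue B
      \<and> cheeger_ratio (E n i) = cheeger_ratio B" if "i < k" for n i
    using borel_core[OF E'(1)[OF that]] by metis
  then have "\<forall>n i. \<exists>B. i < k \<longrightarrow> B \<in> sets borel \<and> B \<subseteq> E n i \<and> emeasure lebesgue (E n i) = emeasure lebesgue B
      \<and> cheeger_ratio (E n i) = cheeger_ratio B"
    by blast
  then obtain B where B: "\<And>n i. i < k \<Longrightarrow> B n i \<in> sets borel" "\<And>n i. i < k \<Longrightarrow> B n i \<subseteq> E n i"
    "\<And>n i. i < k \<Longrightarrow> emeasure lebesgue (E n i) = emeasure lebesgue (B n i)"
    "\<And>n i. i < k \<Longrightarrow> cheeger_ratio (E n i) = cheeger_ratio (B n i)"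
    by metis
  have B_sub: "B n i \<subseteq> \<Omega>" "B n i \<subseteq> cball 0 R" if "i < k" for n i
    using B(2)[OF that] E'(2)[OF that] R by blast+
  have B_fin: "emeasure lborel (B n i) < \<infinity>" if "i < k" for n i
    by (rule emeasure_finite_mono[OF B_sub(2)[OF that]]) (auto simp: emeasure_lborel_cball_finite)
  have B_pos: "0 < measure lborel (B n i)" if "i < k" for n i
    using E'(3)[OF that, of n] B(1,3)[OF that, of n] B_fin[OF that, of n]
    by (simp add: measure_def enn2real_positive_iff)
  have P: "perimeter (B n i) \<le> ereal (K * measure lborel (B n i))" if "i < k" for n i
  proof -
    have "perimeter (B n i) / ereal (measure lborel (B n i)) \<le> ereal K"
      using ratio[OF that, of n] B(1,4)[OF that, of n]
      by (simp add: cheeger_ratio_def measure_lebesgue_eq_lborel)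
    then show ?thesis
      using B_pos[OF that, of n] by (subst (asm) ereal_divide_le_pos) (auto simp: mult.commute)
  qed
  define M where "M = measure lborel (cball (0::'a) R)"
  have "K * measure lborel (B n i) \<le> \<bar>K\<bar> * M" if "i < k" for n i
  proof -
    have "measure lborel (B n i) \<le> M"
      unfolding M_def using B_sub(2)[OF that] B(1)[OF that] emeasure_lborel_cball_finite
      by (intro measure_mono_fmeasurable) (auto intro!: fmeasurableI)
    then show ?thesis by (intro mult_mono) auto
  qed
  then have P': "perimeter (B n i) \<le> ereal (\<bar>K\<bar> * M)" if "i < k" for n i
    using P[OF that] that by (meson ereal_less_eq(3) order_trans)
  obtain s where s: "strict_mono (s :: nat \<Rightarrow> nat)" and AE:
    "\<And>i. i < k \<Longrightarrow> AE x in lborel. \<forall>\<^sub>F n in sequentially.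
        x \<in> B (s n) i \<longleftrightarrow> (\<forall>\<^sub>F m in sequentially. x \<in> B (s m) i)"
    by (rule convergent_subsequence_of_perimeter_le[of \<Omega> k B "\<bar>K\<bar> * M",
          OF \<open>bounded \<Omega>\<close> B(1) B_sub(1) P']) (assumption+, rule that)
  \<comment> \<open>A point in \<open>F i\<close> and \<open>F j\<close> would lie in
    \<open>B (s m) i\<close> and \<open>B (s m) j\<close> for a common \<open>m\<close>, so the
    limits are disjoint without removing null sets.\<close>
  define F where "F i = {x. \<forall>\<^sub>F m in sequentially. x \<in> B (s m) i}" for i
  \<comment> \<open>The lower volume bound of \<open>measure_ge_of_ratio_le\<close>: it depends on
    \<open>K\<close> and the dimension only, hence is the same along the sequence.\<close>
  define d where "d = measure lborel (ball (0::'a) (1 / (4 * (\<bar>K\<bar> + 1)))) / 2"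
  have "0 < d" unfolding d_def by (intro divide_pos_pos measure_ball_pos) auto
  have d: "d \<le> measure lborel (B n i)" if "i < k" for n i
    unfolding d_def by (rule measure_ge_of_ratio_le[OF B(1) B_fin B_pos P]) (fact that)+
  have F_meas: "F i \<in> sets borel" if "i < k" for i
  proof -
    note B(1)[OF that, measurable]
    show ?thesis unfolding F_def eventually_sequentially by measurable
  qed
  have F: "d \<le> measure lborel (F i)" "cheeger_ratio (F i) \<le> liminf (\<lambda>n. cheeger_ratio (B (s n) i))"
    if "i < k" for i
    using cheeger_ratio_le_Liminf[of "\<lambda>n. B (s n) i" R "F i" d]
      B(1)[OF that] B_sub(2)[OF that] F_meas[OF that] AE[OF that] d[OF that] \<open>0 < d\<close>
    by (auto simp: F_def)
  have F_E: "\<exists>n. x \<in> E (s n) i" if "x \<in> F i" "i < k" for x i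
    using that B(2) eventually_happens'[of sequentially] unfolding F_def by fastforce
  have "F \<in> admissible_tuples k \<Omega>"
    unfolding admissible_tuples_def
  proof (intro CollectI conjI allI impI)
    fix i assume i: "i < k"
    show "F i \<in> sets lebesgue" using F_meas[OF i] by simp
    show "F i \<subseteq> \<Omega>" using F_E[OF _ i] E'(2)[OF i] by blast
    show "0 < emeasure lebesgue (F i)"
    proof (rule ccontr)
      assume "\<not> ?thesis"
      then have "measure lborel (F i) = 0" using F_meas[OF i] by (simp add: measure_def)
      then show False using F(1)[OF i] \<open>0 < d\<close> by simp
    qed
    fix j assume j: "j < k" "i \<noteq> j"
    have False if "x \<in> F i" "x \<in> F j" for x
    proof -
      have "\<forall>\<^sub>F m in sequentially. x \<in> B (s m) i \<and> x \<in> B (s m) j"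
        using that by (auto simp: F_def intro: eventually_conj)
      then obtain m where "x \<in> B (s m) i" "x \<in> B (s m) j"
        using eventually_happens'[of sequentially] by auto
      then show False using B(2)[OF i] B(2)[OF j(1)] E_disj[OF i j] by blast
    qed
    then show "F i \<inter> F j = {}" by blast
  qed
  then show thesis using s F(2) B(4) by (intro that[of s F]) auto
qed

section \<open>Cutting along half-spaces\<close>

text \<open>The step is an iterated difference of squared positive parts, whose derivative is a tent.\<close>

lemma C1_step_function:
  obtains s s' :: "real \<Rightarrow> real" where
    "\<And>u. (s has_real_derivative s' u) (at u)" "continuous_on UNIV s'"
    "\<And>u. \<bar>s u\<bar> \<le> 1" "\<And>u. u \<le> 0 \<Longrightarrow> s u = 0" "\<And>u. 1 \<le> u \<Longrightarrow> s u = 1"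
    "\<And>u. \<bar>s' u\<bar> \<le> 2" "\<And>u. u \<le> 0 \<or> 1 < u \<Longrightarrow> s' u = 0"
proof
  let ?q = "\<lambda>u::real. (max 0 u)\<^sup>2"
  \<comment> \<open>The coefficients let the derivative rise with slope 4 to height 2 at 1/2 and
    return to 0 at 1. The tent has area 1, so the step ends at the value 1.\<close>
  let ?s = "\<lambda>u. 2 * ?q u - 4 * ?q (u - 1/2) + 2 * ?q (u - 1)"
  let ?s' = "\<lambda>u::real. 4 * max 0 u - 8 * max 0 (u - 1/2) + 4 * max 0 (u - 1)"
  have q: "((\<lambda>u. ?q (u - c)) has_real_derivative 2 * max 0 (u - c)) (at u)" for u c
  proof -
    have "((\<lambda>u. u - c) has_real_derivative 1) (at u)" by (auto intro!: derivative_eq_intros)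
    from DERIV_chain2[where f = ?q and g = "\<lambda>u. u - c" and x = u, OF DERIV_max_0_power2 this]
    show ?thesis by simp
  qed
  show "(?s has_real_derivative ?s' u) (at u)" for u
    using DERIV_add[OF DERIV_diff[OF DERIV_cmult[OF DERIV_max_0_power2[of u], of 2]
      DERIV_cmult[OF q[of "1/2" u], of 4]] DERIV_cmult[OF q[of 1 u], of 2]]
    by simp
  show "continuous_on UNIV ?s'" by (intro continuous_intros)
  show "\<bar>?s u\<bar> \<le> 1" for u
  proof -
    consider "u \<le> 0" | "0 < u" "u < 1/2" | "1/2 \<le> u" "u \<le> 1" | "1 < u" by linarith
    then show ?thesis
    proof cases
      case 2
      then have "u\<^sup>2 \<le> (1/2)\<^sup>2" by (intro power_mono) auto
      with 2 show ?thesis by (simp add: max_def power2_eq_square)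
    next
      case 3
      then have "(1 - u)\<^sup>2 \<le> (1/2)\<^sup>2" by (intro power_mono) auto
      then have le: "(1 - u)\<^sup>2 \<le> 1/4" by (simp add: power_divide)
      have eq: "?s u = 1 - 2 * (1 - u)\<^sup>2"
        using 3 by (simp add: max_def power2_eq_square algebra_simps)
      show ?thesis
        unfolding eq abs_le_iff using le zero_le_power2[of "1 - u"] by linarith
    next
      case 4
      then show ?thesis by (simp add: max_def power2_eq_square algebra_simps)
    qed simp
  qed
  show "u \<le> 0 \<Longrightarrow> ?s u = 0" for u by simp
  show "1 \<le> u \<Longrightarrow> ?s u = 1" for u by (simp add: max_def power2_eq_square algebra_simps)
  show "\<bar>?s' u\<bar> \<le> 2" for u by (simp add: max_def)
  show "u \<le> 0 \<or> 1 < u \<Longrightarrow> ?s' u = 0" for u by (auto simp: max_def)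
qed

lemma measure_slab_le:
  fixes E :: "'a::euclidean_space set"
  assumes "E \<in> sets borel" "E \<subseteq> cball 0 R" "0 \<le> R" "b \<in> Basis" "0 \<le> e"
  shows "measure lborel {x \<in> E. t < x \<bullet> b \<and> x \<bullet> b \<le> t + e} \<le> (2 * R) ^ (DIM('a) - 1) * e"
proof -
  let ?l = "\<Sum>i\<in>Basis. (if i = b then t else - R) *\<^sub>R i"
  let ?u = "\<Sum>i\<in>Basis. (if i = b then t + e else R) *\<^sub>R i"
  have "{x \<in> E. t < x \<bullet> b \<and> x \<bullet> b \<le> t + e} \<subseteq> cbox ?l ?u"
  proof
    fix x assume x: "x \<in> {x \<in> E. t < x \<bullet> b \<and> x \<bullet> b \<le> t + e}"
    then have "norm x \<le> R" using assms(2) by auto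
    then have "\<bar>x \<bullet> i\<bar> \<le> R" if "i \<in> Basis" for i
      using Basis_le_norm[OF that, of x] by simp
    with x show "x \<in> cbox ?l ?u" by (auto simp: mem_box abs_le_iff) (smt (verit))+
  qed
  then have "measure lborel {x \<in> E. t < x \<bullet> b \<and> x \<bullet> b \<le> t + e} \<le> measure lborel (cbox ?l ?u)"
    by (rule measure_mono_fmeasurable) (use assms(1) in measurable)
  also have "\<dots> = (\<Prod>i\<in>Basis. ?u \<bullet> i - ?l \<bullet> i)"
    using assms by (intro content_cbox) auto
  also have "\<dots> = (\<Prod>i\<in>Basis. if i = b then e else 2 * R)"
    by (intro prod.cong) auto
  also have "\<dots> = e * (\<Prod>i\<in>Basis - {b}. if i = b then e else 2 * R)"
    using assms(4) by (subst prod.remove[of _ b]) auto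
  also have "(\<Prod>i\<in>Basis - {b}. if i = b then e else 2 * R) = (\<Prod>i\<in>Basis - {b}. 2 * R)"
    by (intro prod.cong) auto
  also have "\<dots> = (2 * R) ^ (DIM('a) - 1)"
    using assms(4) by (simp add: card_Diff_singleton)
  finally show ?thesis by (simp add: mult.commute)
qed

text \<open>\<open>E\<close> is tested with the field multiplied by a steepening step across the
  hyperplane. The gradient of the step is at most \<open>2 * Suc n\<close> and lives in a slab of
  \<open>E\<close> of measure at most \<open>L / Suc n\<close>. The product \<open>2 * L\<close>
  does not depend on \<open>n\<close> and bounds what the cut adds.\<close>

lemma perimeter_Int_halfspace_le:
  fixes E :: "'a::euclidean_space set"
  assumes E: "E \<in> sets borel" "E \<subseteq> cball 0 R" and P: "perimeter E \<le> ereal C" and b: "b \<in> Basis"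
    and slab: "\<And>e. 0 < e \<Longrightarrow> measure lborel {x \<in> E. t < x \<bullet> b \<and> x \<bullet> b \<le> t + e} \<le> L * e"
  shows "perimeter (E \<inter> {x. t < x \<bullet> b}) \<le> ereal (C + 2 * L)"
proof (rule perimeter_leI)
  fix \<phi> :: "'a \<Rightarrow> 'a" assume \<phi>: "\<phi> \<in> test_fields"
  note E(1)[measurable]
  have fin: "emeasure lborel A < \<infinity>" if "A \<subseteq> E" for A
    by (rule emeasure_finite_mono[of _ "cball 0 R"])
       (use that E in \<open>auto simp: emeasure_lborel_cball_finite\<close>)
  obtain \<phi>' R' where d\<phi>: "has_C1_derivative \<phi> \<phi>'" and \<phi>0: "\<And>x. R' < norm x \<Longrightarrow> \<phi> x = 0"
    and \<phi>1: "\<And>x. norm (\<phi> x) \<le> 1" and div: "\<And>x. divergence \<phi> x = (\<Sum>b\<in>Basis. \<phi>' x b \<bullet> b)"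
    by (rule test_fields_cases[OF \<phi>]) (rule that)
  obtain B where B: "\<And>x. \<bar>divergence \<phi> x\<bar> \<le> B" using divergence_test_field(2)[OF \<phi>] by blast
  have [measurable]: "divergence \<phi> \<in> borel_measurable borel" "\<phi> \<in> borel_measurable borel"
    using divergence_test_field(1)[OF \<phi>] has_C1_derivative_continuous[OF d\<phi>]
    by (auto intro: borel_measurable_continuous_onI)
  obtain s s' :: "real \<Rightarrow> real" where s: "\<And>u. (s has_real_derivative s' u) (at u)" "continuous_on UNIV s'"
    "\<And>u. \<bar>s u\<bar> \<le> 1" "\<And>u. u \<le> 0 \<Longrightarrow> s u = 0" "\<And>u. 1 \<le> u \<Longrightarrow> s u = 1"
    "\<And>u. \<bar>s' u\<bar> \<le> 2" "\<And>u. u \<le> 0 \<or> 1 < u \<Longrightarrow> s' u = 0"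
    by (rule C1_step_function) (rule that)
  have "continuous_on UNIV s" using s(1) by (meson DERIV_continuous continuous_at_imp_continuous_on)
  then have [measurable]: "s \<in> borel_measurable borel" "s' \<in> borel_measurable borel"
    using s(2) by (auto intro: borel_measurable_continuous_onI)
  \<comment> \<open>Scaled signed distance to the hyperplane: \<open>s (a n x)\<close> climbs from 0
    to 1 across a slab of thickness \<open>1 / Suc n\<close>.\<close>
  define a where "a n x = real (Suc n) * (x \<bullet> b - t)" for n x
  have [measurable]: "a n \<in> borel_measurable borel" for n unfolding a_def by measurable
  have da: "has_C1_derivative (a n) (\<lambda>x v. real (Suc n) * (v \<bullet> b))" for n
    using has_C1_derivative_add[OF has_C1_derivative_bounded_linear[of "\<lambda>x. real (Suc n) * (x \<bullet> b)"]
        has_C1_derivative_const[of "- (real (Suc n) * t)"]]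
    unfolding a_def by (simp add: algebra_simps bounded_linear_intros)
  have main: "(LINT x|lborel. indicator E x * (s (a n x) * divergence \<phi> x)) \<le> C + 2 * L" for n
  proof -
    \<comment> \<open>The part of the divergence that comes from differentiating the step; the
      Kronecker delta of the basis leaves only the component of \<phi> along
      \<open>b\<close>.\<close>
    let ?g = "\<lambda>x. indicator E x * (s' (a n x) * real (Suc n) * (\<phi> x \<bullet> b))"
    let ?S = "{x \<in> E. t < x \<bullet> b \<and> x \<bullet> b \<le> t + 1 / real (Suc n)}"
    have d: "has_C1_derivative (\<lambda>x. s (a n x) *\<^sub>R \<phi> x)
        (\<lambda>x v. s (a n x) *\<^sub>R \<phi>' x v + (s' (a n x) * (real (Suc n) * (v \<bullet> b))) *\<^sub>R \<phi> x)"
      by (rule has_C1_derivative_scaleR[OF has_C1_derivative_compose_real[OF da s(1,2)] d\<phi>])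
    have div': "(\<Sum>i\<in>Basis. (s (a n x) *\<^sub>R \<phi>' x i + (s' (a n x) * (real (Suc n) * (i \<bullet> b))) *\<^sub>R \<phi> x) \<bullet> i)
        = s (a n x) * divergence \<phi> x + s' (a n x) * real (Suc n) * (\<phi> x \<bullet> b)" for x
    proof -
      have "(\<Sum>i\<in>Basis. s' (a n x) * (real (Suc n) * (i \<bullet> b)) * (\<phi> x \<bullet> i))
          = (\<Sum>i\<in>Basis. if i = b then s' (a n x) * real (Suc n) * (\<phi> x \<bullet> i) else 0)"
        using b by (intro sum.cong) (auto simp: inner_Basis)
      then show ?thesis
        using b by (simp add: div inner_add_left sum.distrib sum_distrib_left)
    qed
    have "(LINT x:E|lebesgue. s (a n x) * divergence \<phi> x + s' (a n x) * real (Suc n) * (\<phi> x \<bullet> b)) \<le> 1 * C"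
      unfolding div'[symmetric]
    proof (rule perimeter_field_bound[OF P d, where R = R'])
      show "norm (s (a n x) *\<^sub>R \<phi> x) \<le> 1" for x
        using s(3)[of "a n x"] \<phi>1[of x] by (simp add: mult_le_one)
    qed (simp add: \<phi>0)
    also have "(LINT x:E|lebesgue. s (a n x) * divergence \<phi> x + s' (a n x) * real (Suc n) * (\<phi> x \<bullet> b)) =
        (LINT x|lborel. indicator E x * (s (a n x) * divergence \<phi> x) + ?g x)"
      by (subst set_integral_lebesgue_eq_lborel) (simp_all add: set_lebesgue_integral_def distrib_left)
    also have "\<dots> = (LINT x|lborel. indicator E x * (s (a n x) * divergence \<phi> x)) + (LINT x|lborel. ?g x)"
    proof (rule Bochner_Integration.integral_add)
      show "integrable lborel (\<lambda>x. indicator E x * (s (a n x) * divergence \<phi> x))"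
      proof (rule Bochner_Integration.integrable_bound[where f = "\<lambda>x. B * indicator E x"])
        show "AE x in lborel. norm (indicator E x * (s (a n x) * divergence \<phi> x)) \<le> norm (B * indicator E x)"
          using mult_mono[OF s(3) B] order_trans[OF abs_ge_zero B]
          by (intro AE_I2) (auto simp: indicator_def abs_mult)
      qed (use fin[of E] E in auto)
      show "integrable lborel ?g"
      proof (rule Bochner_Integration.integrable_bound[where f = "\<lambda>x. 2 * real (Suc n) * indicator E x"])
        have "\<bar>s' (a n x) * real (Suc n) * (\<phi> x \<bullet> b)\<bar> \<le> 2 * real (Suc n)" for x
          using mult_mono[OF mult_right_mono[OF s(6)[of "a n x"], of "real (Suc n)"]
              order_trans[OF Basis_le_norm[OF b] \<phi>1[of x]]] by (simp add: abs_mult)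
        then show "AE x in lborel. norm (?g x) \<le> norm (2 * real (Suc n) * indicator E x)"
          by (intro AE_I2) (auto simp: indicator_def)
      qed (use fin[of E] E in auto)
    qed
    finally have "(LINT x|lborel. indicator E x * (s (a n x) * divergence \<phi> x)) \<le> C - (LINT x|lborel. ?g x)"
      by simp
    also have "\<dots> \<le> C + norm (LINT x|lborel. ?g x)" by simp
    also have "norm (LINT x|lborel. ?g x) \<le> (LINT x|lborel. norm (?g x))"
      by (rule integral_norm_bound)
    also have "\<dots> \<le> (LINT x|lborel. 2 * real (Suc n) * indicator ?S x)"
    proof (rule integral_mono_AE')
      show "integrable lborel (\<lambda>x. 2 * real (Suc n) * indicator ?S x)"
        by (intro integrable_mult_right integrable_real_indicator) (use fin[of ?S] in auto)
      show "AE x in lborel. norm (?g x) \<le> 2 * real (Suc n) * indicator ?S x"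
      proof (intro AE_I2)
        fix x
        have 1: "\<bar>s' (a n x) * real (Suc n) * (\<phi> x \<bullet> b)\<bar> \<le> 2 * real (Suc n)"
          using mult_mono[OF mult_right_mono[OF s(6)[of "a n x"], of "real (Suc n)"]
              order_trans[OF Basis_le_norm[OF b] \<phi>1[of x]]] by (simp add: abs_mult)
        have "s' (a n x) = 0" if "\<not> (t < x \<bullet> b \<and> x \<bullet> b \<le> t + 1 / real (Suc n))"
        proof (intro s(7), cases "t < x \<bullet> b")
          case True
          then have "1 / real (Suc n) < x \<bullet> b - t" using that by simp
          then show "a n x \<le> 0 \<or> 1 < a n x"
            by (simp add: a_def divide_less_eq mult.commute del: of_nat_Suc)
        next
          case False
          then show "a n x \<le> 0 \<or> 1 < a n x" by (simp add: a_def mult_le_0_iff)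
        qed
        with 1 show "norm (?g x) \<le> 2 * real (Suc n) * indicator ?S x"
          by (auto simp: indicator_def)
      qed
    qed simp
    also have "\<dots> = 2 * real (Suc n) * measure lborel ?S" by simp
    also have "\<dots> \<le> 2 * real (Suc n) * (L * (1 / real (Suc n)))"
      by (intro mult_left_mono slab) auto
    also have "\<dots> = 2 * L" by (simp add: field_simps del: of_nat_Suc)
    finally show ?thesis by simp
  qed
  have "(\<lambda>n. LINT x|lborel. indicator E x * (s (a n x) * divergence \<phi> x)) \<longlonglongrightarrow>
     (LINT x|lborel. indicator (E \<inter> {x. t < x \<bullet> b}) x * divergence \<phi> x)"
  proof (rule integral_dominated_convergence[where w = "\<lambda>x. B * indicator E x"])
    show "integrable lborel (\<lambda>x. B * indicator E x)"
      by (intro integrable_mult_right integrable_real_indicator) (use fin[of E] in auto)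
    show "AE x in lborel. norm (indicator E x * (s (a n x) * divergence \<phi> x)) \<le> B * indicator E x" for n
      using mult_mono[OF s(3) B] by (intro AE_I2) (auto simp: indicator_def abs_mult)
    \<comment> \<open>On the hyperplane \<open>a n x = 0\<close> and \<open>s 0 = 0\<close>, so the
      limit belongs to the open half-space.\<close>
    have "(\<lambda>n. s (a n x)) \<longlonglongrightarrow> indicator {x. t < x \<bullet> b} x" for x
    proof (cases "t < x \<bullet> b")
      case True
      obtain n0 where "1 / (x \<bullet> b - t) < real n0" using reals_Archimedean2 by blast
      then have "1 \<le> a n x" if "n0 \<le> n" for n
        using that True unfolding a_def
        by (smt (verit) divide_less_eq mult_right_mono of_nat_Suc of_nat_mono)
      then have "\<forall>\<^sub>F n in sequentially. s (a n x) = 1"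
        using s(5) unfolding eventually_sequentially by blast
      then show ?thesis using True by (simp add: tendsto_eventually)
    next
      case False
      then have "s (a n x) = 0" for n by (intro s(4)) (simp add: a_def mult_le_0_iff)
      then show ?thesis using False by simp
    qed
    then show "AE x in lborel. (\<lambda>n. indicator E x * (s (a n x) * divergence \<phi> x))
        \<longlonglongrightarrow> indicator (E \<inter> {x. t < x \<bullet> b}) x * divergence \<phi> x"
      unfolding indicator_inter_arith mult.assoc by (intro AE_I2 tendsto_intros)
  qed measurable
  then have "(LINT x|lborel. indicator (E \<inter> {x. t < x \<bullet> b}) x * divergence \<phi> x) \<le> C + 2 * L"
    using main by (intro LIMSEQ_le_const2) auto
  then show "(LINT x:E \<inter> {x. t < x \<bullet> b}|lebesgue. divergence \<phi> x) \<le> C + 2 * L"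
    by (subst set_integral_lebesgue_eq_lborel) (auto simp: set_lebesgue_integral_def)
qed

text \<open>The integral over \<open>E - F\<close> is the integral over \<open>E\<close> plus the
  integral over \<open>F\<close> for the opposite field, which is again a test field.\<close>

lemma perimeter_Diff_le:
  fixes E F :: "'a::euclidean_space set"
  assumes E: "E \<in> sets borel" "E \<subseteq> cball 0 R" and F: "F \<in> sets borel" "F \<subseteq> E"
    and P: "perimeter E \<le> ereal C" "perimeter F \<le> ereal D"
  shows "perimeter (E - F) \<le> ereal (C + D)"
proof (rule perimeter_leI)
  fix \<phi> :: "'a \<Rightarrow> 'a" assume \<phi>: "\<phi> \<in> test_fields"
  obtain \<phi>' R' where d\<phi>: "has_C1_derivative \<phi> \<phi>'" and \<phi>0: "\<And>x. R' < norm x \<Longrightarrow> \<phi> x = 0"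
    and \<phi>1: "\<And>x. norm (\<phi> x) \<le> 1" and div: "\<And>x. divergence \<phi> x = (\<Sum>b\<in>Basis. \<phi>' x b \<bullet> b)"
    by (rule test_fields_cases[OF \<phi>]) (rule that)
  obtain B where B: "\<And>x. \<bar>divergence \<phi> x\<bar> \<le> B" using divergence_test_field(2)[OF \<phi>] by blast
  have meas: "divergence \<phi> \<in> borel_measurable borel"
    using divergence_test_field(1)[OF \<phi>] by (rule borel_measurable_continuous_onI)
  have int: "integrable lborel (\<lambda>x. indicator A x * divergence \<phi> x)" if A: "A \<in> sets borel" "A \<subseteq> E" for A
  proof (rule Bochner_Integration.integrable_bound[where f = "\<lambda>x. B * indicator A x"])
    have "emeasure lborel A < \<infinity>"
      by (rule emeasure_finite_mono[of _ "cball 0 R"])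
         (use A E in \<open>auto simp: emeasure_lborel_cball_finite\<close>)
    then show "integrable lborel (\<lambda>x. B * indicator A x)"
      using A by (intro integrable_mult_right integrable_real_indicator) auto
    show "AE x in lborel. norm (indicator A x * divergence \<phi> x) \<le> norm (B * indicator A x)"
      using B order_trans[OF abs_ge_zero B] by (intro AE_I2) (auto simp: indicator_def)
  qed (use meas A in measurable)
  have d: "has_C1_derivative (\<lambda>x. - \<phi> x) (\<lambda>x v. - \<phi>' x v)"
    using has_C1_derivative_scaleR[OF has_C1_derivative_const[of "-1"] d\<phi>] by simp
  have "(LINT x:F|lebesgue. (\<Sum>b\<in>Basis. (- \<phi>' x b) \<bullet> b)) \<le> 1 * D"
    by (rule perimeter_field_bound[OF P(2) d, where R = R']) (use \<phi>0 \<phi>1 in auto)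
  then have "(LINT x:F|lebesgue. - divergence \<phi> x) \<le> D" by (simp add: sum_negf div)
  then have "- (LINT x:F|lborel. divergence \<phi> x) \<le> D"
    using meas F by (subst (asm) set_integral_lebesgue_eq_lborel) (simp_all add: set_lebesgue_integral_def)
  moreover have "(LINT x:E|lborel. divergence \<phi> x) \<le> C"
    using perimeter_leD[OF P(1) \<phi>] meas E by (simp add: set_integral_lebesgue_eq_lborel)
  moreover have "(LINT x:E - F|lborel. divergence \<phi> x) =
      (LINT x:E|lborel. divergence \<phi> x) - (LINT x:F|lborel. divergence \<phi> x)"
    unfolding set_lebesgue_integral_def real_scaleR_def
    by (subst Bochner_Integration.integral_diff[OF int int, symmetric])
       (use E F in \<open>auto intro!: Bochner_Integration.integral_cong simp: indicator_def\<close>)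
  ultimately show "(LINT x:E - F|lebesgue. divergence \<phi> x) \<le> C + D"
    using meas E F by (simp add: set_integral_lebesgue_eq_lborel)
qed

lemma perimeter_lessE:
  assumes "perimeter E < \<infinity>"
  obtains C where "perimeter E \<le> ereal C"
  using assms perimeter_nonneg[of E] by (cases "perimeter E") auto

text \<open>The volume beyond the hyperplane \<open>x \<bullet> b = t\<close> is Lipschitz in
  \<open>t\<close> by the slab bound, so some \<open>t\<close> halves it. The same slab bound
  controls the perimeter of the piece.\<close>

lemma halve_set:
  fixes E :: "'a::euclidean_space set"
  assumes E: "E \<in> sets borel" "E \<subseteq> cball 0 R" "0 \<le> R" "0 < measure lborel E"
  obtains A where "A \<in> sets borel" "A \<subseteq> E" "0 < measure lborel A" "0 < measure lborel (E - A)"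
    "perimeter E < \<infinity> \<Longrightarrow> perimeter A < \<infinity>" "perimeter E < \<infinity> \<Longrightarrow> perimeter (E - A) < \<infinity>"
proof -
  note E(1)[measurable]
  obtain b :: 'a where b: "b \<in> Basis" using nonempty_Basis by blast
  define L where "L = (2 * R) ^ (DIM('a) - 1)"
  have "0 \<le> L" using E(3) by (simp add: L_def)
  have slab: "measure lborel {x \<in> E. t < x \<bullet> b \<and> x \<bullet> b \<le> t + e} \<le> L * e" if "0 \<le> e" for t e
    unfolding L_def by (rule measure_slab_le[OF E(1-3) b that])
  have fm: "A \<in> fmeasurable lborel" if "A \<subseteq> E" "A \<in> sets borel" for A
    using emeasure_finite_mono[of A "cball 0 R" lborel] that E emeasure_lborel_cball_finite
    by (intro fmeasurableI) auto
  define H where "H t = E \<inter> {x. t < x \<bullet> b}" for t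
  have [measurable]: "H t \<in> sets borel" for t unfolding H_def by measurable
  define f where "f t = measure lborel (H t)" for t
  have lip: "f t \<le> f u + L * (u - t)" if "t \<le> u" for t u
  proof -
    have "f t \<le> measure lborel (H u \<union> {x \<in> E. t < x \<bullet> b \<and> x \<bullet> b \<le> t + (u - t)})"
      unfolding f_def
    proof (rule measure_mono_fmeasurable)
      show "H u \<union> {x \<in> E. t < x \<bullet> b \<and> x \<bullet> b \<le> t + (u - t)} \<in> fmeasurable lborel"
        by (rule fm) (auto simp: H_def)
    qed (auto simp: H_def)
    also have "\<dots> \<le> f u + measure lborel {x \<in> E. t < x \<bullet> b \<and> x \<bullet> b \<le> t + (u - t)}"
      unfolding f_def by (rule measure_Un_le) auto
    also have "\<dots> \<le> f u + L * (u - t)" using slab[of "u - t" t] that by simp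
    finally show ?thesis .
  qed
  have mono: "f u \<le> f t" if "t \<le> u" for t u
    unfolding f_def by (rule measure_mono_fmeasurable) (use that in \<open>auto simp: H_def intro!: fm\<close>)
  have "L-lipschitz_on UNIV f"
  proof (rule lipschitz_onI)
    show "dist (f t) (f u) \<le> L * dist t u" for t u
      using lip[of t u] lip[of u t] mono[of t u] mono[of u t]
      by (cases "t \<le> u") (auto simp: dist_real_def abs_real_def)
  qed (fact \<open>0 \<le> L\<close>)
  then have cont: "continuous_on {- R - 1..R} f"
    using lipschitz_on_continuous_on continuous_on_subset by blast
  have abs_le: "\<bar>x \<bullet> b\<bar> \<le> R" if "x \<in> E" for x
    using E(2) that Basis_le_norm[OF b, of x] by auto
  \<comment> \<open>The cut is strict, so at \<open>t = - R\<close> a point of \<open>E\<close> with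
    \<open>x \<bullet> b = - R\<close> could be lost; one unit further gives all of
    \<open>E\<close>.\<close>
  have "H R = {}" "H (- R - 1) = E"
    using abs_le by (auto simp: H_def abs_le_iff) fastforce+
  then have "f R \<le> measure lborel E / 2" "measure lborel E / 2 \<le> f (- R - 1)"
    using E(4) by (auto simp: f_def)
  from IVT2'[OF this _ cont] obtain t where t: "f t = measure lborel E / 2"
    using E(3) by auto
  have sub: "H t \<subseteq> E" by (auto simp: H_def)
  have "measure lborel (E - H t) = measure lborel E - f t"
    unfolding f_def by (rule measure_Diff) (use fm[of E] sub in \<open>auto simp: fmeasurable_def\<close>)
  moreover have P: "perimeter (H t) < \<infinity> \<and> perimeter (E - H t) < \<infinity>" if fin: "perimeter E < \<infinity>"
  proof -
    obtain C where C: "perimeter E \<le> ereal C" using fin by (rule perimeter_lessE)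
    have 1: "perimeter (H t) \<le> ereal (C + 2 * L)"
      unfolding H_def by (rule perimeter_Int_halfspace_le[OF E(1,2) C b slab]) simp
    moreover have "perimeter (E - H t) \<le> ereal (C + (C + 2 * L))"
      by (rule perimeter_Diff_le[OF E(1,2) _ sub C 1]) simp
    ultimately show ?thesis by (auto intro: le_less_trans)
  qed
  ultimately show thesis
    using t E(4) sub by (intro that[of "H t"]) (auto simp: f_def)
qed

text \<open>One half is kept and the other is split again. Finite perimeter appears as an
  implication because the lemma also has to serve a set of infinite perimeter.\<close>

lemma exists_disjoint_subsets:
  fixes E :: "'a::euclidean_space set" and k :: nat
  assumes "E \<in> sets borel" "E \<subseteq> cball 0 R" "0 \<le> R" "0 < measure lborel E"
  shows "\<exists>F. (\<forall>i<k. F i \<in> sets borel \<and> F i \<subseteq> E \<and> 0 < measure lborel (F i) \<and>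
      (perimeter E < \<infinity> \<longrightarrow> perimeter (F i) < \<infinity>)) \<and> (\<forall>i<k. \<forall>j<k. i \<noteq> j \<longrightarrow> F i \<inter> F j = {})"
  using assms
proof (induction k arbitrary: E)
  case (Suc k)
  obtain A where A: "A \<in> sets borel" "A \<subseteq> E" "0 < measure lborel A" "0 < measure lborel (E - A)"
    "perimeter E < \<infinity> \<Longrightarrow> perimeter A < \<infinity>" "perimeter E < \<infinity> \<Longrightarrow> perimeter (E - A) < \<infinity>"
    by (rule halve_set[OF Suc.prems]) (rule that)
  have "E - A \<in> sets borel" "E - A \<subseteq> cball 0 R" using Suc.prems A by auto
  from Suc.IH[OF this \<open>0 \<le> R\<close> A(4)] obtain F where
    F: "\<forall>i<k. F i \<in> sets borel \<and> F i \<subseteq> E - A \<and> 0 < measure lborel (F i) \<and>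
        (perimeter (E - A) < \<infinity> \<longrightarrow> perimeter (F i) < \<infinity>)"
      "\<forall>i<k. \<forall>j<k. i \<noteq> j \<longrightarrow> F i \<inter> F j = {}"
    by (elim exE conjE)
  show ?case
  proof (intro exI[of _ "F(k := A)"] conjI allI impI)
    fix i assume i: "i < Suc k"
    show "(F(k := A)) i \<in> sets borel" "(F(k := A)) i \<subseteq> E" "0 < measure lborel ((F(k := A)) i)"
      using i A(1-3) F(1) by (auto simp: less_Suc_eq)
    show "perimeter ((F(k := A)) i) < \<infinity>" if "perimeter E < \<infinity>"
      using i A(5,6)[OF that] F(1) by (auto simp: less_Suc_eq)
    fix j assume "j < Suc k" "i \<noteq> j"
    then show "(F(k := A)) i \<inter> (F(k := A)) j = {}"
      using i F by (auto simp: less_Suc_eq) blast+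
  qed
qed simp

section \<open>Lexicographic minimisation\<close>

text \<open>The hypothesis combines sequential compactness of \<open>X\<close> with lower
  semicontinuity, with a single limit for all coordinates. The induction minimises the next
  coordinate over the set of minimisers of the previous ones.\<close>

lemma exists_lex_minimal:
  fixes f :: "nat \<Rightarrow> 'x \<Rightarrow> ereal"
  assumes "X \<noteq> {}"
    and compact: "\<And>u. (\<And>n. u n \<in> X) \<Longrightarrow> \<exists>x\<in>X. \<exists>s::nat \<Rightarrow> nat. strict_mono s \<and>
      (\<forall>j<m. f j x \<le> liminf (\<lambda>n. f j (u (s n))))"
  shows "\<exists>x\<in>X. \<forall>y\<in>X. \<forall>j<m. (\<forall>i<j. f i y \<le> f i x) \<longrightarrow> f j x \<le> f j y"
  using compact
proof (induction m)
  case 0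
  then show ?case using \<open>X \<noteq> {}\<close> by blast
next
  case (Suc m)
  define Y where "Y = {x\<in>X. \<forall>y\<in>X. \<forall>j<m. (\<forall>i<j. f i y \<le> f i x) \<longrightarrow> f j x \<le> f j y}"
  have "\<exists>x\<in>X. \<exists>s::nat \<Rightarrow> nat. strict_mono s \<and> (\<forall>j<m. f j x \<le> liminf (\<lambda>n. f j (u (s n))))"
    if u: "\<And>n. u n \<in> X" for u
  proof -
    obtain x s where "x \<in> X" "strict_mono (s :: nat \<Rightarrow> nat)"
      "\<forall>j<Suc m. f j x \<le> liminf (\<lambda>n. f j (u (s n)))"
      using Suc.prems[of u, OF u] by (elim bexE exE conjE)
    then show ?thesis by (intro bexI[of _ x] exI[of _ s]) auto
  qed
  from Suc.IH[OF this] have "Y \<noteq> {}" unfolding Y_def by blast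
  \<comment> \<open>Two minimisers compare in both directions, so the first \<open>m\<close>
    coordinates are constant on \<open>Y\<close>.\<close>
  have eq: "f j x = f j y" if "x \<in> Y" "y \<in> Y" "j < m" for x y j
    using \<open>j < m\<close>
  proof (induction j rule: less_induct)
    case (less j)
    then show ?case using that(1,2) by (intro antisym) (auto simp: Y_def)
  qed
  obtain u where u: "\<And>n. u n \<in> f m ` Y" "u \<longlonglongrightarrow> Inf (f m ` Y)"
    using Inf_as_limit[of "f m ` Y"] \<open>Y \<noteq> {}\<close> by blast
  have "\<forall>n. \<exists>y. y \<in> Y \<and> u n = f m y" using u(1) by blast
  then obtain v where "\<forall>n. v n \<in> Y \<and> u n = f m (v n)" by (rule choice[THEN exE])
  then have v: "\<And>n. v n \<in> Y" "\<And>n. u n = f m (v n)" by simp_all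
  then have v_X: "v n \<in> X" for n by (simp add: Y_def)
  obtain x s where x: "x \<in> X" and s: "strict_mono (s :: nat \<Rightarrow> nat)"
    and "\<forall>j<Suc m. f j x \<le> liminf (\<lambda>n. f j (v (s n)))"
    using Suc.prems[of v, OF v_X] by (elim bexE exE conjE)
  then have le: "\<And>j. j < Suc m \<Longrightarrow> f j x \<le> liminf (\<lambda>n. f j (v (s n)))" by simp
  \<comment> \<open>\<open>Y\<close> is not known to be closed. The limit is no worse than
    \<open>Y\<close> in the first \<open>m\<close> coordinates, and minimality of \<open>v 0\<close>
    then forces equality, which is what membership in \<open>Y\<close> was wanted for.\<close>
  have le_v: "f j x \<le> f j (v 0)" if "j < m" for j
  proof -
    have "f j (v (s n)) = f j (v 0)" for n by (rule eq[OF v(1) v(1) that])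
    then have "(\<lambda>n. f j (v (s n))) = (\<lambda>n. f j (v 0))" by (rule ext)
    then have "liminf (\<lambda>n. f j (v (s n))) = f j (v 0)" by (simp only:) (rule Liminf_const, simp)
    then show ?thesis using le[of j] that by simp
  qed
  have f_x: "f j x = f j (v 0)" if "j < m" for j
    using that
  proof (induction j rule: less_induct)
    case (less j)
    have "f j (v 0) \<le> f j x"
      using v(1)[of 0] x less.prems le_v by (auto simp: Y_def)
    then show ?case using le_v[OF less.prems] by (intro antisym)
  qed
  have "(u \<circ> s) \<longlonglongrightarrow> Inf (f m ` Y)" using u(2) s by (rule LIMSEQ_subseq_LIMSEQ)
  then have "liminf (u \<circ> s) = Inf (f m ` Y)" by (intro lim_imp_Liminf) auto
  then have f_m: "f m x \<le> Inf (f m ` Y)" using le[of m] by (simp add: comp_def v(2))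
  have "f j x \<le> f j y" if "y \<in> X" "j < Suc m" "\<forall>i<j. f i y \<le> f i x" for y j
  proof (cases "j < m")
    case True
    then show ?thesis using v(1)[of 0] that f_x by (auto simp: Y_def)
  next
    case False
    then have "j = m" using that(2) by simp
    \<comment> \<open>A competitor that is no worse in the first \<open>m\<close> coordinates is
      itself minimal in them, so the infimum over \<open>Y\<close> applies to it.\<close>
    have "y \<in> Y"
      unfolding Y_def
    proof (intro CollectI conjI ballI allI impI)
      fix z i assume z: "z \<in> X" "i < m" "\<forall>l<i. f l z \<le> f l y"
      have "f i y \<le> f i (v 0)" using that(3) f_x z(2) \<open>j = m\<close> by simp
      also have "\<dots> \<le> f i z"
        using v(1)[of 0] z that(3) f_x \<open>j = m\<close> unfolding Y_def
        by (smt (verit, best) mem_Collect_eq order_trans less_trans)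
      finally show "f i y \<le> f i z" .
    qed (fact that(1))
    then show ?thesis using f_m \<open>j = m\<close> by (meson INF_lower order_trans)
  qed
  with x show ?case by blast
qed

section \<open>Order statistics of finitely many values\<close>

text \<open>For \<open>j < k\<close> this is the \<open>j\<close>-th largest of \<open>r 0, \<dots>, r (k - 1)\<close>, counted from \<open>0\<close>.\<close>

definition ordered_value :: "nat \<Rightarrow> (nat \<Rightarrow> ereal) \<Rightarrow> nat \<Rightarrow> ereal" where
  "ordered_value k r j = Inf {c. card {i\<in>{..<k}. c < r i} \<le> j}"

text \<open>Reduces every later statement about order statistics to counting. From right to left a
  gap is needed to keep the infimum strictly above \<open>c\<close>: the least of the finitely many
  values above \<open>c\<close> provides it.\<close>

lemma less_ordered_value_iff:
  "c < ordered_value k r j \<longleftrightarrow> j < card {i\<in>{..<k}. c < r i}"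
proof
  assume c: "c < ordered_value k r j"
  show "j < card {i\<in>{..<k}. c < r i}"
  proof (rule ccontr)
    assume "\<not> ?thesis"
    then have "ordered_value k r j \<le> c" unfolding ordered_value_def by (intro Inf_lower) simp
    with c show False by simp
  qed
next
  assume *: "j < card {i\<in>{..<k}. c < r i}"
  let ?S = "{i\<in>{..<k}. c < r i}"
  have "?S \<noteq> {}" using * by (metis card.empty not_less0)
  have "Min (r ` ?S) \<le> c'" if "card {i\<in>{..<k}. c' < r i} \<le> j" for c'
  proof (rule ccontr)
    assume "\<not> ?thesis"
    then have "?S \<subseteq> {i\<in>{..<k}. c' < r i}"
      by (auto simp: not_le intro: less_le_trans)
    then have "card ?S \<le> card {i\<in>{..<k}. c' < r i}" by (intro card_mono) auto
    then show False using * that by simp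
  qed
  then have "Min (r ` ?S) \<le> ordered_value k r j" unfolding ordered_value_def by (auto intro: Inf_greatest)
  moreover have "c < Min (r ` ?S)" using \<open>?S \<noteq> {}\<close> by (subst Min_gr_iff) auto
  ultimately show "c < ordered_value k r j" by simp
qed

text \<open>Each of the finitely many entries above \<open>c\<close> stays above \<open>c\<close>
  eventually, so the count cannot drop.\<close>

lemma ordered_value_le_Liminf:
  assumes "\<And>i. i < k \<Longrightarrow> r i \<le> liminf (\<lambda>n. q n i)"
  shows "ordered_value k r j \<le> liminf (\<lambda>n. ordered_value k (q n) j)"
  unfolding le_Liminf_iff
proof (intro allI impI)
  fix c assume "c < ordered_value k r j"
  then have c: "j < card {i\<in>{..<k}. c < r i}" by (simp add: less_ordered_value_iff)
  have "\<forall>\<^sub>F n in sequentially. \<forall>i\<in>{i\<in>{..<k}. c < r i}. c < q n i"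
    using assms by (intro eventually_ball_finite) (auto simp: le_Liminf_iff)
  then show "\<forall>\<^sub>F n in sequentially. c < ordered_value k (q n) j"
  proof eventually_elim
    case (elim n)
    then have "card {i\<in>{..<k}. c < r i} \<le> card {i\<in>{..<k}. c < q n i}" by (intro card_mono) auto
    with c show ?case by (simp add: less_ordered_value_iff)
  qed
qed

text \<open>Lowering the maximum over the index set \<open>I\<close> below its value \<open>M\<close> changes no entry above \<open>M\<close>
  and removes one from the entries that are at least \<open>M\<close>.\<close>

lemma ordered_value_less_of_lowered:
  assumes I: "I \<subseteq> {..<k}" "i0 \<in> I" "r i0 = M"
    and r: "\<And>i. i \<in> I \<Longrightarrow> r i \<le> M" and q: "\<And>i. i \<in> I \<Longrightarrow> q i < M"
    and eq: "\<And>i. i < k \<Longrightarrow> i \<notin> I \<Longrightarrow> q i = r i"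
  obtains j where "j < k" "ordered_value k q j < ordered_value k r j"
    "\<And>i. i < j \<Longrightarrow> ordered_value k q i \<le> ordered_value k r i"
proof -
  let ?S = "{i\<in>{..<k}. M \<le> r i}"
  let ?T = "{i\<in>{..<k}. M \<le> q i}"
  have "i0 \<in> ?S" using I by auto
  then have "0 < card ?S" by (auto simp: card_gt_0_iff)
  \<comment> \<open>The last position, counted from 0, whose value is at least \<open>M\<close>.
    After the change at most \<open>j\<close> entries are that large, so position \<open>j\<close>
    falls below \<open>M\<close>.\<close>
  define j where "j = card ?S - 1"
  have j: "card ?S = Suc j" using \<open>0 < card ?S\<close> by (simp add: j_def)
  have "card ?S \<le> card {..<k}" by (intro card_mono) auto
  then have "j < k" using j by simp
  have "?T \<subseteq> ?S - {i0}"
    using eq q I by (auto simp: not_le[symmetric]) metis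
  then have "card ?T \<le> card (?S - {i0})" by (intro card_mono) auto
  also have "\<dots> = j" using \<open>i0 \<in> ?S\<close> j by (subst card_Diff_singleton) auto
  finally have T: "card ?T \<le> j" .
  have M_le: "M \<le> ordered_value k r i" if "i \<le> j" for i
  proof (rule ccontr)
    let ?c = "ordered_value k r i"
    assume "\<not> M \<le> ?c"
    then have "?S \<subseteq> {i\<in>{..<k}. ?c < r i}" by auto
    then have "card ?S \<le> card {i\<in>{..<k}. ?c < r i}" by (intro card_mono) auto
    then have "?c < ?c" using j \<open>i \<le> j\<close> by (subst less_ordered_value_iff) simp
    then show False by simp
  qed
  \<comment> \<open>Up to position \<open>j\<close> the old value is at least \<open>M\<close>;
    above such a threshold no lowered entry is counted, and the other entries agree.\<close>
  have le: "ordered_value k q i \<le> ordered_value k r i" if "i \<le> j" for i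
  proof (rule ccontr)
    let ?c = "ordered_value k r i"
    assume "\<not> ?thesis"
    then have "?c < ordered_value k q i" by simp
    then have "i < card {i\<in>{..<k}. ?c < q i}" by (simp only: less_ordered_value_iff)
    moreover have "{i\<in>{..<k}. ?c < q i} \<subseteq> {i\<in>{..<k}. ?c < r i}"
      using eq q M_le[OF that] by (auto simp: subset_iff) (metis less_trans not_le order_le_less_trans)
    then have "card {i\<in>{..<k}. ?c < q i} \<le> card {i\<in>{..<k}. ?c < r i}" by (intro card_mono) auto
    ultimately have "?c < ?c" by (subst less_ordered_value_iff) simp
    then show False by simp
  qed
  let ?L = "{i\<in>{..<k}. q i < M}"
  have L: "finite ?L" "?L \<noteq> {}" using I q by auto
  \<comment> \<open>The largest new value below \<open>M\<close>. It separates position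
    \<open>j\<close> from \<open>M\<close>: the new value there is at most \<open>c\<close>, which
    yields the strict inequality.\<close>
  define c where "c = Max (q ` ?L)"
  have "c < M" unfolding c_def using L by (subst Max_less_iff) auto
  have "{i\<in>{..<k}. c < q i} \<subseteq> ?T"
  proof safe
    fix i assume i: "i < k" "c < q i"
    show "M \<le> q i"
    proof (rule ccontr)
      assume "\<not> M \<le> q i"
      then have "q i \<le> c" unfolding c_def using L i by (intro Max_ge) auto
      with i show False by simp
    qed
  qed
  then have "card {i\<in>{..<k}. c < q i} \<le> card ?T" by (intro card_mono) auto
  with T have "\<not> c < ordered_value k q j" by (simp add: less_ordered_value_iff)
  with \<open>c < M\<close> M_le[of j] have "ordered_value k q j < ordered_value k r j" by simp
  with \<open>j < k\<close> le show thesis by (intro that[of j]) auto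
qed

section \<open>From minimality to adjustedness\<close>

lemma cheeger_ratio_eq_infty_iff:
  assumes "0 < measure lebesgue A"
  shows "cheeger_ratio A = \<infinity> \<longleftrightarrow> perimeter A = \<infinity>"
  using assms perimeter_nonneg[of A]
  by (cases "perimeter A") (auto simp: cheeger_ratio_def)

text \<open>The removed sets in the definition of \<open>adjusted\<close> are exactly those held
  fixed, so a competing \<open>l\<close>-tuple extends to a full \<open>k\<close>-tuple. The premise
  is free of orderings and ratio bounds, so it fits both the lexicographic minimiser and the case of
  infinite ratios.\<close>

lemma adjusted_of_no_improvement:
  assumes E: "E \<in> admissible_tuples k \<Omega>" and "1 \<le> k"
    and no: "\<And>I G. I \<subseteq> {..<k} \<Longrightarrow> I \<noteq> {} \<Longrightarrow> G \<in> admissible_tuples k \<Omega> \<Longrightarrow>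
      (\<And>i. i < k \<Longrightarrow> i \<notin> I \<Longrightarrow> G i = E i) \<Longrightarrow>
      (SUP i\<in>I. cheeger_ratio (E i)) \<le> (SUP i\<in>I. cheeger_ratio (G i))"
  shows "adjusted n k \<Omega> E"
proof -
  have sub: "cheeger_tuple l (\<Omega> - (\<Union>j\<in>{..<k} - \<sigma> ` {..<l}. E j)) (E \<circ> \<sigma>)"
    if l: "1 \<le> l" and \<sigma>: "inj_on \<sigma> {..<l}" "\<sigma> ` {..<l} \<subseteq> {..<k}" for l \<sigma>
  proof -
    let ?I = "\<sigma> ` {..<l}"
    let ?D = "\<Omega> - (\<Union>j\<in>{..<k} - ?I. E j)"
    have \<sigma>_k: "\<sigma> i < k" if "i < l" for i using \<sigma>(2) that by auto
    have E': "E i \<in> sets lebesgue" "E i \<subseteq> \<Omega>" "0 < emeasure lebesgue (E i)" if "i < k" for i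
      using E that by (auto simp: admissible_tuples_def)
    have E_disj: "E i \<inter> E j = {}" if "i < k" "j < k" "i \<noteq> j" for i j
      using E that by (auto simp: admissible_tuples_def)
    have adm: "E \<circ> \<sigma> \<in> admissible_tuples l ?D"
      unfolding admissible_tuples_def
    proof (intro CollectI conjI allI impI)
      fix i assume i: "i < l"
      show "(E \<circ> \<sigma>) i \<in> sets lebesgue" "0 < emeasure lebesgue ((E \<circ> \<sigma>) i)"
        using E'[OF \<sigma>_k[OF i]] by simp_all
      have "E (\<sigma> i) \<inter> E j = {}" if "j \<in> {..<k} - ?I" for j
        using that i \<sigma>_k[OF i] by (intro E_disj) auto
      then show "(E \<circ> \<sigma>) i \<subseteq> ?D" using E'(2)[OF \<sigma>_k[OF i]] by auto
      fix j assume j: "j < l" "i \<noteq> j"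
      then have "\<sigma> i \<noteq> \<sigma> j" using \<sigma>(1) i by (auto simp: inj_on_def)
      then show "(E \<circ> \<sigma>) i \<inter> (E \<circ> \<sigma>) j = {}"
        using E_disj[OF \<sigma>_k[OF i] \<sigma>_k[OF j(1)]] by simp
    qed
    have "tuple_value l (E \<circ> \<sigma>) \<le> tuple_value l H" if H: "H \<in> admissible_tuples l ?D" for H
    proof -
      define \<tau> where "\<tau> = inv_into {..<l} \<sigma>"
      have \<tau>: "\<tau> i < l" "\<sigma> (\<tau> i) = i" if "i \<in> ?I" for i
        using inv_into_into[OF that] f_inv_into_f[OF that] by (auto simp: \<tau>_def)
      have \<tau>_\<sigma>: "\<tau> (\<sigma> i) = i" if "i < l" for i
        using \<sigma>(1) that by (auto simp: \<tau>_def)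
      \<comment> \<open>The competitor is put back in the positions selected by \<sigma>. It avoids
        the remaining sets, since it lies in \<open>?D\<close>.\<close>
      define G where "G i = (if i \<in> ?I then H (\<tau> i) else E i)" for i
      have H': "H i \<in> sets lebesgue" "H i \<subseteq> ?D" "0 < emeasure lebesgue (H i)" if "i < l" for i
        using H that by (auto simp: admissible_tuples_def)
      have H_disj: "H i \<inter> H j = {}" if "i < l" "j < l" "i \<noteq> j" for i j
        using H that by (auto simp: admissible_tuples_def)
      have G_disj: "H (\<tau> i) \<inter> E j = {}" if "i \<in> ?I" "j < k" "j \<notin> ?I" for i j
        using H'(2)[OF \<tau>(1)[OF that(1)]] that by blast
      have "G \<in> admissible_tuples k \<Omega>"
        unfolding admissible_tuples_def
      proof (intro CollectI conjI allI impI)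
        fix i assume i: "i < k"
        show "G i \<in> sets lebesgue" "0 < emeasure lebesgue (G i)"
          using E'[OF i] H'[OF \<tau>(1), of i] by (simp_all add: G_def)
        show "G i \<subseteq> \<Omega>"
          using E'(2)[OF i] H'(2)[OF \<tau>(1), of i] by (auto simp: G_def)
        fix j assume j: "j < k" "i \<noteq> j"
        have "\<tau> i \<noteq> \<tau> j" if "i \<in> ?I" "j \<in> ?I" using \<tau>(2)[OF that(1)] \<tau>(2)[OF that(2)] j(2) by auto
        then show "G i \<inter> G j = {}"
          using G_disj[of i j] G_disj[of j i] H_disj[OF \<tau>(1) \<tau>(1), of i j] E_disj[OF i j(1,2)] i j(1)
          unfolding G_def by (simp add: Int_commute)
      qed
      moreover have "?I \<noteq> {}" using l by (auto simp: lessThan_empty_iff)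
      moreover have "G i = E i" if "i \<notin> ?I" for i using that by (simp add: G_def)
      ultimately have "(SUP i\<in>?I. cheeger_ratio (E i)) \<le> (SUP i\<in>?I. cheeger_ratio (G i))"
        by (intro no \<sigma>(2))
      moreover have "(SUP i\<in>?I. cheeger_ratio (G i)) = (SUP i\<in>{..<l}. cheeger_ratio (H i))"
        unfolding image_image by (intro SUP_cong) (auto simp: G_def \<tau>_\<sigma>)
      ultimately show ?thesis by (simp add: tuple_value_def image_image)
    qed
    then have "tuple_value l (E \<circ> \<sigma>) \<le> cheeger_const l ?D"
      unfolding cheeger_const_def by (rule INF_greatest)
    moreover have "cheeger_const l ?D \<le> tuple_value l (E \<circ> \<sigma>)"
      unfolding cheeger_const_def by (rule INF_lower[OF adm])
    ultimately show ?thesis unfolding cheeger_tuple_def using adm by (blast intro: antisym)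
  qed
  \<comment> \<open>With all indices selected nothing is removed from \<Omega>.\<close>
  moreover have "cheeger_tuple k \<Omega> E" using sub[of k id] \<open>1 \<le> k\<close> by simp
  ultimately show ?thesis unfolding adjusted_def by auto
qed

lemma adjusted_of_lex_minimal:
  assumes E: "E \<in> admissible_tuples k \<Omega>" "\<And>i. i < k \<Longrightarrow> cheeger_ratio (E i) \<le> ereal K" and "1 \<le> k"
    and lex: "\<And>G j. G \<in> admissible_tuples k \<Omega> \<Longrightarrow> (\<And>i. i < k \<Longrightarrow> cheeger_ratio (G i) \<le> ereal K) \<Longrightarrow>
      j < k \<Longrightarrow>
      (\<forall>i<j. ordered_value k (\<lambda>i. cheeger_ratio (G i)) i \<le> ordered_value k (\<lambda>i. cheeger_ratio (E i)) i) \<Longrightarrow>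
      ordered_value k (\<lambda>i. cheeger_ratio (E i)) j \<le> ordered_value k (\<lambda>i. cheeger_ratio (G i)) j"
  shows "adjusted n k \<Omega> E"
proof (rule adjusted_of_no_improvement[OF E(1) \<open>1 \<le> k\<close>], rule ccontr)
  fix I G
  assume I: "I \<subseteq> {..<k}" "I \<noteq> {}" and G: "G \<in> admissible_tuples k \<Omega>"
    and eq: "\<And>i. i < k \<Longrightarrow> i \<notin> I \<Longrightarrow> G i = E i"
  let ?r = "\<lambda>i. cheeger_ratio (E i)" and ?q = "\<lambda>i. cheeger_ratio (G i)"
  define M where "M = (SUP i\<in>I. ?r i)"
  assume "\<not> (SUP i\<in>I. ?r i) \<le> (SUP i\<in>I. ?q i)"
  then have less: "(SUP i\<in>I. ?q i) < M" by (simp add: M_def)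
  have "finite I" using I(1) finite_subset by blast
  then have "M = Max (?r ` I)" using I(2) by (simp add: M_def Max_Sup)
  moreover have "Max (?r ` I) \<in> ?r ` I" using \<open>finite I\<close> I(2) by (intro Max_in) auto
  ultimately obtain i0 where i0: "i0 \<in> I" "?r i0 = M" by auto
  have r: "?r i \<le> M" if "i \<in> I" for i unfolding M_def by (rule SUP_upper[OF that])
  have q: "?q i < M" if "i \<in> I" for i using SUP_upper[OF that, of ?q] less by (rule le_less_trans)
  have eq': "?q i = ?r i" if "i < k" "i \<notin> I" for i using eq[OF that] by simp
  obtain j where j: "j < k" "ordered_value k ?q j < ordered_value k ?r j"
    "\<And>i. i < j \<Longrightarrow> ordered_value k ?q i \<le> ordered_value k ?r i"
    by (rule ordered_value_less_of_lowered[of I k i0 ?r M ?q, OF I(1) i0 r q eq']) (assumption+, rule that)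
  \<comment> \<open>The competitor remains in the class where \<open>lex\<close> applies: its
    changed ratios are below \<open>M\<close>, which is itself a ratio of \<open>E\<close>.\<close>
  have "?q i \<le> ereal K" if "i < k" for i
  proof (cases "i \<in> I")
    case True
    then have "?q i < M" by (rule q)
    also have "M \<le> ereal K" using i0 I(1) E(2)[of i0] by auto
    finally show ?thesis by simp
  next
    case False
    then show ?thesis using E(2)[OF that] eq[OF that] by simp
  qed
  then have "ordered_value k ?r j \<le> ordered_value k ?q j" using j by (intro lex G) auto
  then show False using j(2) by simp
qed

section \<open>Existence of adjusted tuples\<close>

theorem theorem2p1:
  fixes \<Omega> :: "'a::euclidean_space set"
  assumes "DIM('a) \<ge> 2"
    and "\<Omega> \<in> sets lebesgue" and "bounded \<Omega>" and "emeasure lebesgue \<Omega> > 0"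
    and "1 \<le> n" and "n \<le> k"
  shows "\<exists>E. adjusted n k \<Omega> E"
proof -
  have "1 \<le> k" using assms(5,6) by simp
  obtain R where R: "\<Omega> \<subseteq> cball 0 R" by (rule bounded_obtain_cball[OF assms(3)])
  have "\<Omega> \<noteq> {}" using assms(4) by auto
  then have "0 \<le> R" using R by (auto simp: subset_iff) (meson ex_in_conv norm_ge_zero order_trans)
  have measure_pos: "0 < measure lebesgue A" if "A \<in> sets lebesgue" "A \<subseteq> \<Omega>" "0 < emeasure lebesgue A" for A
  proof -
    have "emeasure lebesgue A < \<infinity>"
      by (rule emeasure_finite_mono[of _ "cball 0 R"])
         (use that R emeasure_lborel_cball_finite in auto)
    then show ?thesis using that(3) by (simp add: measure_def enn2real_positive_iff)
  qed
  \<comment> \<open>Used twice: with a set of finite perimeter to obtain finite ratios, and with a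
    Borel core of \<Omega> merely to obtain an admissible tuple.\<close>
  have ex: "\<exists>F \<in> admissible_tuples k \<Omega>.
      perimeter A < \<infinity> \<longrightarrow> (\<forall>i<k. cheeger_ratio (F i) < \<infinity>)"
    if A: "A \<in> sets borel" "A \<subseteq> \<Omega>" "0 < emeasure lebesgue A" for A
  proof -
    have "0 < measure lborel A"
      using measure_pos[of A] A by (simp add: measure_lebesgue_eq_lborel)
    moreover have "A \<subseteq> cball 0 R" using A(2) R by blast
    ultimately obtain F where F:
      "\<forall>i<k. F i \<in> sets borel \<and> F i \<subseteq> A \<and> 0 < measure lborel (F i) \<and>
        (perimeter A < \<infinity> \<longrightarrow> perimeter (F i) < \<infinity>)"
      "\<forall>i<k. \<forall>j<k. i \<noteq> j \<longrightarrow> F i \<inter> F j = {}"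
      using exists_disjoint_subsets[OF A(1) _ \<open>0 \<le> R\<close>, of k] by (elim exE conjE meta_impE)
    have pos: "0 < measure lebesgue (F i)" if "i < k" for i
      using F(1) that by (simp add: measure_lebesgue_eq_lborel)
    have "0 < emeasure lebesgue (F i)" if "i < k" for i
      using pos[OF that] by (auto simp: measure_def enn2real_positive_iff)
    moreover have "F i \<subseteq> \<Omega>" if "i < k" for i using F(1) A(2) that by blast
    ultimately have "F \<in> admissible_tuples k \<Omega>"
      using F unfolding admissible_tuples_def by auto
    moreover have "cheeger_ratio (F i) < \<infinity>" if "i < k" "perimeter A < \<infinity>" for i
      using F(1) that cheeger_ratio_eq_infty_iff[OF pos[OF that(1)]] by auto
    ultimately show ?thesis by blast
  qed
  show ?thesis
  proof (cases "\<exists>A\<in>sets lebesgue. A \<subseteq> \<Omega> \<and> 0 < emeasure lebesgue A \<and> cheeger_ratio A < \<infinity>")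
    case True
    then obtain A where A: "A \<in> sets lebesgue" "A \<subseteq> \<Omega>" "0 < emeasure lebesgue A" "cheeger_ratio A < \<infinity>"
      by blast
    obtain B where B: "B \<in> sets borel" "B \<subseteq> A" "emeasure lebesgue A = emeasure lebesgue B"
      "cheeger_ratio A = cheeger_ratio B"
      by (rule borel_core[OF A(1)])
    have B': "B \<subseteq> \<Omega>" "0 < emeasure lebesgue B" using A B by auto
    then have "perimeter B < \<infinity>"
      using A(4) B(1,4) cheeger_ratio_eq_infty_iff[OF measure_pos[of B]] by auto
    then obtain F where F: "F \<in> admissible_tuples k \<Omega>" "\<And>i. i < k \<Longrightarrow> cheeger_ratio (F i) < \<infinity>"
      using ex[OF B(1) B'] by auto
    \<comment> \<open>Inserting 0 keeps \<open>v\<close> away from negative infinity, so that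
      together with \<open>v < \<infinity>\<close> it is a real number.\<close>
    define v where "v = Max (insert 0 ((\<lambda>i. cheeger_ratio (F i)) ` {..<k}))"
    have "v < \<infinity>" unfolding v_def using F(2) by (subst Max_less_iff) auto
    moreover have "0 \<le> v" "\<And>i. i < k \<Longrightarrow> cheeger_ratio (F i) \<le> v"
      by (simp_all add: v_def)
    ultimately obtain K where K: "v = ereal K" by (cases v) auto
    define X where "X = {E \<in> admissible_tuples k \<Omega>. \<forall>i<k. cheeger_ratio (E i) \<le> ereal K}"
    let ?f = "\<lambda>j E. ordered_value k (\<lambda>i. cheeger_ratio (E i)) j"
    have "F \<in> X" using F(1) \<open>\<And>i. i < k \<Longrightarrow> cheeger_ratio (F i) \<le> v\<close> by (auto simp: X_def K)
    have "\<exists>E\<in>X. \<forall>G\<in>X. \<forall>j<k. (\<forall>i<j. ?f i G \<le> ?f i E) \<longrightarrow> ?f j E \<le> ?f j G"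
    proof (rule exists_lex_minimal)
      show "X \<noteq> {}" using \<open>F \<in> X\<close> by blast
      fix u :: "nat \<Rightarrow> nat \<Rightarrow> 'a set"
      assume u: "\<And>n. u n \<in> X"
      have "u n \<in> admissible_tuples k \<Omega>" "i < k \<Longrightarrow> cheeger_ratio (u n i) \<le> ereal K" for n i
        using u[of n] by (auto simp: X_def)
      then obtain s E where s: "strict_mono (s :: nat \<Rightarrow> nat)" "E \<in> admissible_tuples k \<Omega>"
        "\<And>i. i < k \<Longrightarrow> cheeger_ratio (E i) \<le> liminf (\<lambda>n. cheeger_ratio (u (s n) i))"
        by (rule admissible_tuples_seq_compact[of \<Omega> u k K, OF assms(3)]) (assumption+, rule that)
      have "cheeger_ratio (E i) \<le> ereal K" if "i < k" for i
      proof -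
        have "liminf (\<lambda>n. cheeger_ratio (u (s n) i)) \<le> liminf (\<lambda>n. ereal K)"
          using u that by (intro Liminf_mono always_eventually) (auto simp: X_def)
        then show ?thesis using s(3)[OF that] by (simp add: Liminf_const)
      qed
      then have "E \<in> X" using s(2) by (simp add: X_def)
      moreover have "?f j E \<le> liminf (\<lambda>n. ?f j (u (s n)))" for j
        by (rule ordered_value_le_Liminf) (rule s(3))
      ultimately show "\<exists>E\<in>X. \<exists>s::nat \<Rightarrow> nat. strict_mono s \<and>
          (\<forall>j<k. ?f j E \<le> liminf (\<lambda>n. ?f j (u (s n))))"
        using s(1) by blast
    qed
    then obtain E where E: "E \<in> X"
      and lex: "\<And>G j. G \<in> X \<Longrightarrow> j < k \<Longrightarrow> \<forall>i<j. ?f i G \<le> ?f i E \<Longrightarrow> ?f j E \<le> ?f j G"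
      by blast
    have "adjusted n k \<Omega> E"
    proof (rule adjusted_of_lex_minimal[where K = K])
      fix G j
      assume "G \<in> admissible_tuples k \<Omega>" "\<And>i. i < k \<Longrightarrow> cheeger_ratio (G i) \<le> ereal K"
      then have "G \<in> X" by (simp add: X_def)
      then show "?f j E \<le> ?f j G" if "j < k" "\<forall>i<j. ?f i G \<le> ?f i E" using that by (rule lex)
    qed (use E \<open>1 \<le> k\<close> in \<open>auto simp: X_def\<close>)
    then show ?thesis by blast
  next
    case False
    \<comment> \<open>Here every ratio is infinite and no tuple improves on another; only disjoint
      sets of positive measure are needed.\<close>
    obtain B where B: "B \<in> sets borel" "B \<subseteq> \<Omega>" "emeasure lebesgue \<Omega> = emeasure lebesgue B"
      by (rule borel_core[OF assms(2)])
    obtain F where F: "F \<in> admissible_tuples k \<Omega>" using ex[OF B(1,2)] B(3) assms(4) by auto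
    have "adjusted n k \<Omega> F"
    proof (rule adjusted_of_no_improvement[OF F \<open>1 \<le> k\<close>])
      fix I G
      assume I: "I \<subseteq> {..<k}" "I \<noteq> {}" and G: "G \<in> admissible_tuples k \<Omega>"
      obtain i where i: "i \<in> I" using I by blast
      then have "G i \<in> sets lebesgue" "G i \<subseteq> \<Omega>" "0 < emeasure lebesgue (G i)"
        using G I by (auto simp: admissible_tuples_def)
      then have "cheeger_ratio (G i) = \<infinity>" using False by auto
      then have "(SUP i\<in>I. cheeger_ratio (G i)) = \<infinity>"
        using SUP_upper[OF i, of "\<lambda>i. cheeger_ratio (G i)"] by simp
      then show "(SUP i\<in>I. cheeger_ratio (F i)) \<le> (SUP i\<in>I. cheeger_ratio (G i))" by simp
    qed
    then show ?thesis by blast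
  qed
qed

end
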